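(* Let $\beta\in(0,1)$, $0<T<\infty$. Suppose that either $g\in C(0,T]$ satisfies $|g(x)|\le Mx^{\alpha-\beta}$ for some $M,\alpha>0$ and all $x\in(0,T]$, or $g\in B[0,T]$. Then, for each starting point $x$ and each $j\in\mathbb N$, $S^c_{\tau_j}$ (given $S^c_0=x$) equals $X_j$ (given $X_0=x$) in law, and $$I_0^\beta g(x)=\sum_{j=0}^\infty\mathbb E_x\big[J_0^\beta g(X_j)\big],\quad x\in(0,T].$$
   Context: Fix $\beta\in(0,1)$ and $0<T<\infty$. $B[0,T]$ is the set of bounded Borel measurable real functions on $[0,T]$. $J_0^\beta g(x)=\int_0^x\frac{(x-r)^{\beta-1}}{\Gamma(\beta)}g(r)\,dr$ for $x\in(0,T]$ and $J_0^\beta g(0)=0$. For $\psi\in C[0,T]$, $\mathcal K\psi(x)=\int_0^x\frac{(x-r)^{\beta-1}r^{-\beta}}{\Gamma(\beta)\Gamma(1-\beta)}\psi(r)\,dr$ for $x>0$, $\mathcal K\psi(0)=\psi(0)$. Define $I_0^\beta g=\sum_{j=0}^\infty\mathcal K^jJ_0^\beta g$ ($\mathcal K^0$ the identity). For $x>0$, $X_0=x$ and $X_j=x\prod_{i=1}^jB_i$, $j\in\mathbb N$, where $\{B_i\}_{i\in\mathbb N}$ are i.i.d. beta-distributed random variables on $(0,1)$ with parameters $(1-\beta,\beta)$, i.e. with density $\frac{(1-r)^{\beta-1}r^{-\beta}}{\Gamma(\beta)\Gamma(1-\beta)}$. A $\beta$-stable subordinator is a (càdlàg) Lévy process $-S=\{-S_s\}_{s\ge0}$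 started at $0$ with $\mathbb E[\exp\{kS_s\}]=\exp\{-sk^\beta\}$, $k,s>0$. Let $\{-S^j\}_{j\in\mathbb N}$ be i.i.d. $\beta$-stable subordinators. For a starting point $x>0$ define recursively $\tau_0=0$; $\widetilde S^1_t=x+S^1_t$; for $j\ge2$, $\widetilde S^j_t=\widetilde S^{j-1}_{\tau_{j-1}-}+S^j_{t-\tau_{j-1}}$; $\tau_j=\inf\{s>\tau_{j-1}:\widetilde S^j_s\le0\}$; $\tau_\infty=\lim_{j\to\infty}\tau_j$ (where $Y_{t-}$ denotes the left limit). The censored decreasing $\beta$-stable process started at $S^c_0=x$ is $S^c_t=\widetilde S^j_t$ for $\tau_{j-1}\le t<\tau_j$, $j\in\mathbb N$, and $S^c_t=\partial$ (a cemetery state) for $t\ge\tau_\infty$. $\mathbb E_x$ is expectation given that the process starts at $x$. *)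

theory Defs
  imports "HOL-Probability.Probability"
begin

subsection \<open>The operators on functions on \<open>[0,T]\<close>\<close>

text \<open>
  Real functions on \<open>[0,T]\<close> are represented by functions \<open>real \<Rightarrow> real\<close>, and the images of the
  operators below are set to 0 off \<open>[0,T]\<close>. The integrals only involve the values of the
  argument on \<open>(0,T)\<close>.
\<close>

definition J_op :: "real \<Rightarrow> real \<Rightarrow> (real \<Rightarrow> real) \<Rightarrow> real \<Rightarrow> real" where
  "J_op T \<beta> g x =
     (if 0 < x \<and> x \<le> T
      then (LBINT r:{0<..<x}. (x - r) powr (\<beta> - 1) / Gamma \<beta> * g r)
      else 0)"

definition K_op :: "real \<Rightarrow> real \<Rightarrow> (real \<Rightarrow> real) \<Rightarrow> real \<Rightarrow> real" where
  "K_op T \<beta> \<psi> x =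
     (if x = 0 then \<psi> 0
      else if 0 < x \<and> x \<le> T
      then (LBINT r:{0<..<x}.
              (x - r) powr (\<beta> - 1) * r powr (- \<beta>) / (Gamma \<beta> * Gamma (1 - \<beta>)) * \<psi> r)
      else 0)"

definition I_op :: "real \<Rightarrow> real \<Rightarrow> (real \<Rightarrow> real) \<Rightarrow> real \<Rightarrow> real" where
  "I_op T \<beta> g x = (\<Sum>j. (K_op T \<beta> ^^ j) (J_op T \<beta> g) x)"

definition bounded_borel_on :: "real set \<Rightarrow> (real \<Rightarrow> real) \<Rightarrow> bool" where
  "bounded_borel_on A g \<longleftrightarrow> g \<in> borel_measurable (restrict_space borel A) \<and> bounded (g ` A)"

subsection \<open>The multiplicative beta chain\<close>

definition iid_vars :: "'w measure \<Rightarrow> 'v measure \<Rightarrow> ('i \<Rightarrow> 'w \<Rightarrow> 'v) \<Rightarrow> 'i set \<Rightarrow> bool" where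
  "iid_vars M E X I \<longleftrightarrow>
     prob_space.indep_vars M (\<lambda>_. E) X I \<and>
     (\<forall>i\<in>I. \<forall>k\<in>I. distr M E (X i) = distr M E (X k))"

definition beta_dens :: "real \<Rightarrow> real \<Rightarrow> real" where
  "beta_dens \<beta> r =
     (if 0 < r \<and> r < 1
      then (1 - r) powr (\<beta> - 1) * r powr (- \<beta>) / (Gamma \<beta> * Gamma (1 - \<beta>))
      else 0)"

definition beta_chain :: "(nat \<Rightarrow> 'w \<Rightarrow> real) \<Rightarrow> real \<Rightarrow> nat \<Rightarrow> 'w \<Rightarrow> real" where
  "beta_chain B x j \<omega> = x * (\<Prod>i=1..j. B i \<omega>)"

subsection \<open>Stable subordinators\<close>

definition cadlag :: "(real \<Rightarrow> real) \<Rightarrow> bool" where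
  "cadlag f \<longleftrightarrow>
     (\<forall>t\<ge>0. continuous (at_right t) f) \<and> (\<forall>t>0. \<exists>l. (f \<longlongrightarrow> l) (at_left t))"

text \<open>
  Continuity in probability is not listed: it follows from stationarity of the increments and
  almost sure right-continuity at 0.
\<close>

definition levy_process :: "'w measure \<Rightarrow> (real \<Rightarrow> 'w \<Rightarrow> real) \<Rightarrow> bool" where
  "levy_process M Y \<longleftrightarrow>
     prob_space M \<and>
     (\<forall>t\<ge>0. Y t \<in> borel_measurable M) \<and>
     (AE \<omega> in M. Y 0 \<omega> = 0) \<and>
     (\<forall>n (t :: nat \<Rightarrow> real). 0 \<le> t 0 \<and> (\<forall>i<n. t i < t (Suc i)) \<longrightarrow>
        prob_space.indep_vars M (\<lambda>_. borel) (\<lambda>i \<omega>. Y (t (Suc i)) \<omega> - Y (t i) \<omega>) {..<n}) \<and>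
     (\<forall>s\<ge>0. \<forall>t\<ge>0. distr M borel (\<lambda>\<omega>. Y (s + t) \<omega> - Y s \<omega>) = distr M borel (Y t)) \<and>
     (AE \<omega> in M. cadlag (\<lambda>t. Y t \<omega>))"

definition stable_subordinator :: "'w measure \<Rightarrow> real \<Rightarrow> (real \<Rightarrow> 'w \<Rightarrow> real) \<Rightarrow> bool" where
  "stable_subordinator M \<beta> Y \<longleftrightarrow>
     levy_process M Y \<and>
     (\<forall>k>0. \<forall>s>0. integrable M (\<lambda>\<omega>. exp (- k * Y s \<omega>)) \<and>
        prob_space.expectation M (\<lambda>\<omega>. exp (- k * Y s \<omega>)) = exp (- s * k powr \<beta>))"

definition path_of :: "(real \<Rightarrow> 'w \<Rightarrow> real) \<Rightarrow> 'w \<Rightarrow> real \<Rightarrow> real" where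
  "path_of Y \<omega> = (\<lambda>t\<in>{0..}. Y t \<omega>)"

abbreviation path_space :: "(real \<Rightarrow> real) measure" where
  "path_space \<equiv> Pi\<^sub>M {0..} (\<lambda>_. borel)"

subsection \<open>The censored process\<close>

text \<open>
  The construction is pathwise: \<open>s j\<close> is the path of the \<open>j\<close>-th driving process, \<open>j \<ge> 1\<close>.
  \<open>cens_tilde s x j\<close> is meaningful for \<open>j \<ge> 1\<close> only. The times are extended reals, the infimum
  of the empty set being \<open>\<infinity>\<close>. If \<open>cens_time s x j = \<infinity>\<close>, then all later times are \<open>\<infinity>\<close> as well
  and \<open>cens_tilde s x (Suc j)\<close>, in whose equation the time is read as 0, is never used by
  \<open>censored\<close>.
\<close>

function (sequential)
  cens_time :: "(nat \<Rightarrow> real \<Rightarrow> real) \<Rightarrow> real \<Rightarrow> nat \<Rightarrow> ereal" and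
  cens_tilde :: "(nat \<Rightarrow> real \<Rightarrow> real) \<Rightarrow> real \<Rightarrow> nat \<Rightarrow> real \<Rightarrow> real"
where
  "cens_time s x 0 = 0"
| "cens_time s x (Suc j) =
     Inf {ereal t | t. cens_time s x j < ereal t \<and> cens_tilde s x (Suc j) t \<le> 0}"
| "cens_tilde s x 0 t = undefined"
| "cens_tilde s x (Suc 0) t = x + s 1 t"
| "cens_tilde s x (Suc (Suc j)) t =
     Lim (at_left (real_of_ereal (cens_time s x (Suc j)))) (\<lambda>u. cens_tilde s x (Suc j) u) +
     s (Suc (Suc j)) (t - real_of_ereal (cens_time s x (Suc j)))"
  by pat_completeness auto
termination
  by (relation "Wellfounded.measure (\<lambda>a. case a of Inl (s, x, j) \<Rightarrow> 2 * j | Inr (s, x, j, t) \<Rightarrow> 2 * j - 1)") auto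

definition cens_lifetime :: "(nat \<Rightarrow> real \<Rightarrow> real) \<Rightarrow> real \<Rightarrow> ereal" where
  "cens_lifetime s x = lim (\<lambda>j. cens_time s x j)"

text \<open>
  \<open>None\<close> is the cemetery state. The time argument is an extended real so that the process can be
  evaluated at the times \<open>cens_time s x j\<close>.
\<close>

definition censored :: "(nat \<Rightarrow> real \<Rightarrow> real) \<Rightarrow> real \<Rightarrow> ereal \<Rightarrow> real option" where
  "censored s x t =
     (if t < cens_lifetime s x
      then Some (cens_tilde s x
             (THE j. 1 \<le> j \<and> cens_time s x (j - 1) \<le> t \<and> t < cens_time s x j)
             (real_of_ereal t))
      else None)"

definition borel_cemetery :: "real option measure" where
  "borel_cemetery = sigma UNIV {Some ` A | A. A \<in> sets borel}"

text \<open>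
  The paths are only almost surely monotone and right-continuous, so functionals of the paths such
  as hitting times are random variables on the completed probability space; laws are
  therefore taken with respect to the completion.
\<close>

definition eq_in_law ::
  "'v measure \<Rightarrow> 'w measure \<Rightarrow> ('w \<Rightarrow> 'v) \<Rightarrow> 'u measure \<Rightarrow> ('u \<Rightarrow> 'v) \<Rightarrow> bool" where
  "eq_in_law E M Y N Z \<longleftrightarrow>
     Y \<in> measurable (completion M) E \<and> Z \<in> measurable (completion N) E \<and>
     distr (completion M) E Y = distr (completion N) E Z"

end

theory Submission
  imports Defs
begin

text \<open>
  Write \<open>Y = -S\<close>. At its first passage over the level \<open>v\<close> the censored path keeps the residual
  \<open>v - Y(\<tau>-)\<close>, where \<open>Y(\<tau>-)\<close> is the supremum of the values of \<open>Y\<close> below \<open>v\<close>. To find its law, sample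
  \<open>Y\<close> at the times \<open>n h\<close> and take the Laplace transform in \<open>v\<close> as well: by independence of the
  increments the transform is a geometric series, which tends to \<open>q\<^sup>\<beta>\<^sup>-\<^sup>1 (l + q)\<^sup>-\<^sup>\<beta>\<close> as \<open>h\<close>
  tends to \<open>0\<close>. This is also the double transform of \<open>v (1 - B)\<close> with \<open>B\<close> beta distributed, being
  a convolution of two Gamma densities. Hence the residual is \<open>v B\<close> in law, and the law of the
  whole chain of residuals follows from the independence of the driving processes. For the series, \<open>K\<close>
  is the transition operator of the beta chain, and the terms decay geometrically because
  \<open>J\<close> maps \<open>g\<close> to a function of order \<open>x\<^sup>\<alpha>\<close> and the \<open>\<alpha>\<close>-th moment of \<open>B\<close> is less than \<open>1\<close>.
\<close>

subsection \<open>Uniqueness of Laplace transforms\<close>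

text \<open>The law of the undershoot at one fixed level is not directly accessible from the Laplace
  exponent. Integrating over the level too replaces the passage event by increments between grid
  times, whose transforms are known. The price is that the two laws are first known to agree only at
  almost every level. Both depend on the level continuously from the left, and this extends the
  equality to every \<open>v > 0\<close>, as a chain started at a given point requires. Nothing in
  the pathwise argument shows that the path jumps over the level instead of creeping up to it;
  creeping would leave residual zero and break the construction. That all residuals are positive is
  therefore read off from their law. Hitting times are kept out of the measure theory: measurability
  and independence are settled for an explicit functional of the driving paths, and the censored
  process is compared with that functional outside a null set. This is where the completions
  enter.\<close>

lemma moments_unique:
  fixes \<mu> \<nu> :: "real measure"
  assumes fin: "finite_measure \<mu>" "finite_measure \<nu>"
    and sets: "sets \<mu> = sets borel" "sets \<nu> = sets borel"
    and supp: "AE x in \<mu>. x \<in> {0..1}" "AE x in \<nu>. x \<in> {0..1}"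
    and eq: "\<And>n::nat. (\<integral>x. x ^ n \<partial>\<mu>) = (\<integral>x. x ^ n \<partial>\<nu>)"
  shows "\<mu> = \<nu>"
proof -
  have bdd_int: "integrable \<kappa> f"
    if "\<kappa> \<in> {\<mu>, \<nu>}" "continuous_on UNIV f" for \<kappa> and f :: "real \<Rightarrow> real"
  proof -
    interpret finite_measure \<kappa> using that fin by auto
    have meas: "f \<in> borel_measurable \<kappa>"
      using that sets borel_measurable_continuous_onI[of f] by (auto simp: measurable_def sets_eq_imp_space_eq[of _ borel])
    have "compact (f ` {0..1})"
      by (intro compact_continuous_image continuous_on_subset[OF that(2)]) auto
    then obtain C where C: "\<And>x. x \<in> {0..1} \<Longrightarrow> norm (f x) \<le> C"
      using compact_imp_bounded[of "f ` {0..1}"] unfolding bounded_iff by blast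
    have "AE x in \<kappa>. x \<in> {0..1}" using that(1) supp by blast
    then have "AE x in \<kappa>. norm (f x) \<le> C" by eventually_elim (rule C)
    then show ?thesis by (intro integrable_const_bound[OF _ meas])
  qed
  have poly: "(\<integral>x. p x \<partial>\<mu>) = (\<integral>x. p x \<partial>\<nu>)" if "real_polynomial_function p" for p :: "real \<Rightarrow> real"
  proof -
    from that obtain a n where p: "p = (\<lambda>x. \<Sum>i\<le>n. a i * x ^ i)"
      unfolding real_polynomial_function_iff_sum by blast
    have "integrable \<kappa> (\<lambda>x. a i * x ^ i)" if "\<kappa> \<in> {\<mu>, \<nu>}" for i \<kappa>
      using that by (rule bdd_int) (intro continuous_intros)
    then show ?thesis unfolding p by (subst (1 2) Bochner_Integration.integral_sum) (auto simp: eq)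
  qed
  \<comment> \<open>Weierstrass approximation on \<open>{0..1}\<close>, where both measures live;
    the two errors add up to at most \<open>e\<close> times the total mass \<open>K\<close>.\<close>
  have cont: "(\<integral>x. f x \<partial>\<mu>) = (\<integral>x. f x \<partial>\<nu>)" if f: "continuous_on UNIV f" for f :: "real \<Rightarrow> real"
  proof -
    define K where "K = measure \<mu> (space \<mu>) + measure \<nu> (space \<nu>)"
    have K: "0 \<le> K" by (simp add: K_def)
    have bound: "\<bar>(\<integral>x. f x \<partial>\<mu>) - (\<integral>x. f x \<partial>\<nu>)\<bar> \<le> e * K" if e: "0 < e" for e
    proof -
      obtain p where p: "real_polynomial_function p" "\<And>x. x \<in> {0..1} \<Longrightarrow> \<bar>f x - p x\<bar> < e"
        using Stone_Weierstrass_real_polynomial_function[of "{0..1::real}" f e] f e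
        by (metis compact_Icc continuous_on_subset subset_UNIV)
      have pc: "continuous_on UNIV p"
        using p(1) continuous_on_polymonial_function real_polynomial_function_eq by blast
      have *: "\<bar>(\<integral>x. f x \<partial>\<kappa>) - (\<integral>x. p x \<partial>\<kappa>)\<bar> \<le> e * measure \<kappa> (space \<kappa>)" if \<kappa>: "\<kappa> \<in> {\<mu>, \<nu>}" for \<kappa>
      proof -
        interpret finite_measure \<kappa> using \<kappa> fin by auto
        have "(\<integral>x. f x \<partial>\<kappa>) - (\<integral>x. p x \<partial>\<kappa>) = (\<integral>x. f x - p x \<partial>\<kappa>)"
          using bdd_int[OF \<kappa> f] bdd_int[OF \<kappa> pc] by simp
        also have "\<bar>\<dots>\<bar> \<le> (\<integral>x. \<bar>f x - p x\<bar> \<partial>\<kappa>)" by (rule integral_abs_bound)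
        also have "\<dots> \<le> (\<integral>x. e \<partial>\<kappa>)"
        proof (rule integral_mono_AE)
          show "integrable \<kappa> (\<lambda>x. \<bar>f x - p x\<bar>)"
            using bdd_int[OF \<kappa> f] bdd_int[OF \<kappa> pc] by simp
          have "AE x in \<kappa>. x \<in> {0..1}" using \<kappa> supp by blast
          then show "AE x in \<kappa>. \<bar>f x - p x\<bar> \<le> e"
            by eventually_elim (use p(2) less_imp_le in blast)
        qed simp
        finally show ?thesis by (simp add: mult.commute)
      qed
      from *[of \<mu>] *[of \<nu>] poly[OF p(1)] show ?thesis by (simp add: K_def algebra_simps)
    qed
    have "\<bar>(\<integral>x. f x \<partial>\<mu>) - (\<integral>x. f x \<partial>\<nu>)\<bar> \<le> 0 + e" if "0 < e" for e
    proof -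
      \<comment> \<open>Dividing by \<open>K + 1\<close> also covers two zero measures, where
        \<open>K = 0\<close>.\<close>
      have "e / (K + 1) * K \<le> e" using K that by (simp add: field_simps)
      with bound[of "e / (K + 1)"] K that show ?thesis by simp
    qed
    then show ?thesis by (metis abs_le_zero_iff eq_iff_diff_eq_0 field_le_epsilon)
  qed
  have Ioi: "emeasure \<mu> {a<..} = emeasure \<nu> {a<..}" for a
  proof -
    \<comment> \<open>Continuous ramps that vanish up to \<open>a\<close> and increase to the
      indicator of the open half-line.\<close>
    define f where "f n x = max 0 (min 1 (real n * (x - a)))" for n x
    have lim: "(\<lambda>n. \<integral>x. f n x \<partial>\<kappa>) \<longlonglongrightarrow> measure \<kappa> {a<..}" if \<kappa>: "\<kappa> \<in> {\<mu>, \<nu>}" for \<kappa>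
    proof -
      interpret finite_measure \<kappa> using \<kappa> fin by auto
      have S: "sets \<kappa> = sets borel" using \<kappa> sets by auto
      note [measurable_cong] = S
      have "(\<lambda>n. \<integral>x. f n x \<partial>\<kappa>) \<longlonglongrightarrow> (\<integral>x. indicator {a<..} x \<partial>\<kappa>)"
      proof (rule integral_dominated_convergence[where w = "\<lambda>_. 1"])
        show "AE x in \<kappa>. (\<lambda>n. f n x) \<longlonglongrightarrow> indicator {a<..} x"
        proof (rule AE_I2)
          fix x
          show "(\<lambda>n. f n x) \<longlonglongrightarrow> indicator {a<..} x"
          proof (cases "a < x")
            case True
            obtain m :: nat where m: "1 / (x - a) < real m" using reals_Archimedean2 by blast
            have "f n x = 1" if "m \<le> n" for n
            proof -
              have "1 \<le> real m * (x - a)" using m True by (simp add: field_simps)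
              also have "\<dots> \<le> real n * (x - a)" using that True by (intro mult_right_mono) auto
              finally show ?thesis by (simp add: f_def)
            qed
            then have "\<forall>\<^sub>F n in sequentially. f n x = 1"
              unfolding eventually_sequentially by blast
            then show ?thesis using True by (simp add: tendsto_eventually)
          next
            case False
            then have "real n * (x - a) \<le> 0" for n by (intro mult_nonneg_nonpos) auto
            then have "f n x = 0" for n unfolding f_def by (metis max.absorb1 min.coboundedI2)
            then show ?thesis using False by simp
          qed
        qed
      qed (auto simp: f_def)
      then show ?thesis using S by (simp add: sets_eq_imp_space_eq[OF S])
    qed
    have "(\<integral>x. f n x \<partial>\<mu>) = (\<integral>x. f n x \<partial>\<nu>)" for n
      unfolding f_def by (rule cont) (intro continuous_intros)
    then have "measure \<mu> {a<..} = measure \<nu> {a<..}"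
      using lim[of \<mu>] lim[of \<nu>] LIMSEQ_unique by auto
    then show ?thesis using fin by (simp add: finite_measure.emeasure_eq_measure)
  qed
  show ?thesis
    by (rule measure_eqI_lessThan)
      (auto simp: sets Ioi finite_measure.emeasure_finite[OF fin(2)] less_top[symmetric])
qed

text \<open>The map \<open>exp (- x)\<close> sends the half-line into \<open>{0..1}\<close> and
  turns the transform at integers into moments; \<open>- ln x\<close> undoes it. Hence a sequence of
  parameters is enough.\<close>

lemma laplace_unique:
  fixes \<mu> \<nu> :: "real measure"
  assumes fin: "finite_measure \<mu>" "finite_measure \<nu>"
    and sets: "sets \<mu> = sets borel" "sets \<nu> = sets borel"
    and supp: "AE x in \<mu>. 0 \<le> x" "AE x in \<nu>. 0 \<le> x"
    and eq: "\<And>n::nat. (\<integral>\<^sup>+x. ennreal (exp (- (real n * x))) \<partial>\<mu>) = (\<integral>\<^sup>+x. ennreal (exp (- (real n * x))) \<partial>\<nu>)"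
  shows "\<mu> = \<nu>"
proof -
  note [measurable_cong] = sets
  let ?e = "\<lambda>x::real. exp (- x)"
  have "distr \<mu> borel ?e = distr \<nu> borel ?e"
  proof (rule moments_unique)
    show "finite_measure (distr \<mu> borel ?e)" "finite_measure (distr \<nu> borel ?e)"
      using fin by (auto intro!: finite_measure.finite_measure_distr)
    show "AE x in distr \<mu> borel ?e. x \<in> {0..1}" "AE x in distr \<nu> borel ?e. x \<in> {0..1}"
      using supp by (auto simp: AE_distr_iff)
    show "(\<integral>x. x ^ n \<partial>distr \<mu> borel ?e) = (\<integral>x. x ^ n \<partial>distr \<nu> borel ?e)" for n
      using eq[of n] by (simp add: integral_distr exp_of_nat_mult[symmetric] integral_eq_nn_integral)
  qed auto
  then have "distr (distr \<mu> borel ?e) borel (\<lambda>x. - ln x) = distr (distr \<nu> borel ?e) borel (\<lambda>x. - ln x)"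
    by simp
  then have "distr \<mu> borel (\<lambda>x. x) = distr \<nu> borel (\<lambda>x. x)"
    by (simp add: distr_distr comp_def)
  then show ?thesis
    using distr_id2[OF sets(1)[symmetric]] distr_id2[OF sets(2)[symmetric]] by simp
qed

subsection \<open>Paths of stable subordinators\<close>

text \<open>What the pathwise arguments use of a subordinator. The last clause makes every first
  passage time finite.\<close>

definition subord_path :: "(real \<Rightarrow> real) \<Rightarrow> bool" where
  "subord_path y \<longleftrightarrow>
     y 0 = 0 \<and> mono_on {0..} y \<and> (\<forall>t\<ge>0. (y \<longlongrightarrow> y t) (at_right t)) \<and> (\<forall>v. \<exists>t\<ge>0. v < y t)"

text \<open>Almost surely, increments can be controlled only for countably many pairs of times. If
  \<open>y s\<close> exceeded \<open>y t\<close>, right-continuity would carry the strict inequality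
  to rational times just after \<open>s\<close> and just after \<open>t\<close>.\<close>

lemma mono_on_rats_imp_mono_on:
  fixes y :: "real \<Rightarrow> real"
  assumes rat: "\<And>s t. s \<in> \<rat> \<Longrightarrow> t \<in> \<rat> \<Longrightarrow> 0 \<le> s \<Longrightarrow> s < t \<Longrightarrow> y s \<le> y t"
    and rc: "\<And>t. 0 \<le> t \<Longrightarrow> (y \<longlongrightarrow> y t) (at_right t)"
  shows "mono_on {0..} y"
proof (rule mono_onI, rule ccontr)
  fix s t assume st: "s \<in> {0..}" "t \<in> {0..}" "s \<le> t" "\<not> y s \<le> y t"
  then have "s < t" by (cases "s = t") auto
  define m where "m = (y s + y t) / 2"
  have m: "y t < m" "m < y s" using st by (auto simp: m_def)
  have "\<forall>\<^sub>F u in at_right s. m < y u" using st m by (intro order_tendstoD(1)[OF rc]) auto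
  then obtain b where b: "s < b" "\<And>u. s < u \<Longrightarrow> u < b \<Longrightarrow> m < y u"
    by (auto simp: eventually_at_right_field)
  have "\<forall>\<^sub>F u in at_right t. y u < m" using st m by (intro order_tendstoD(2)[OF rc]) auto
  then obtain c where c: "t < c" "\<And>u. t < u \<Longrightarrow> u < c \<Longrightarrow> y u < m"
    by (auto simp: eventually_at_right_field)
  obtain q where q: "q \<in> \<rat>" "s < q" "q < min b t"
    using Rats_dense_in_real[of s "min b t"] b \<open>s < t\<close> by auto
  obtain r where r: "r \<in> \<rat>" "t < r" "r < c" using Rats_dense_in_real[of t c] c by auto
  have "y q \<le> y r" using q r st by (intro rat) auto
  moreover have "m < y q" "y r < m" using b(2)[of q] c(2)[of r] q r by auto
  ultimately show False by simp
qed

text \<open>Markov's inequality for \<open>exp (- k * X)\<close>. It serves with large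
  \<open>k\<close> to show that a subordinator is nonnegative and with \<open>k = 1\<close> at large
  times to show that it is unbounded.\<close>

lemma (in prob_space) Chernoff_exp_neg:
  assumes X: "X \<in> borel_measurable M" and int: "integrable M (\<lambda>\<omega>. exp (- k * X \<omega>))" and k: "0 < k"
  shows "prob {\<omega> \<in> space M. X \<omega> \<le> a} \<le> exp (k * a) * expectation (\<lambda>\<omega>. exp (- k * X \<omega>))"
proof -
  let ?A = "{\<omega> \<in> space M. X \<omega> \<le> a}"
  have A: "?A \<in> sets M" using X by measurable
  have "prob ?A = expectation (indicator ?A)" using A by simp
  also have "\<dots> \<le> expectation (\<lambda>\<omega>. exp (k * a) * exp (- k * X \<omega>))"
  proof (rule integral_mono)
    show "indicator ?A \<omega> \<le> exp (k * a) * exp (- k * X \<omega>)" for \<omega>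
      using k by (auto simp: indicator_def exp_add[symmetric] intro!: mult_left_mono)
  qed (use int A in \<open>auto simp: integrable_indicator_iff less_top[symmetric]\<close>)
  finally show ?thesis by simp
qed

text \<open>Monotone and unbounded paths are not part of the definition; both properties come from
  the Laplace transform.\<close>

lemma stable_subordinator_AE_subord_path:
  assumes Y: "stable_subordinator M \<beta> Y"
  shows "AE \<omega> in M. subord_path (\<lambda>t. Y t \<omega>)"
proof -
  have lev: "levy_process M Y"
    and int: "\<And>k s. 0 < k \<Longrightarrow> 0 < s \<Longrightarrow> integrable M (\<lambda>\<omega>. exp (- k * Y s \<omega>))"
    and tf: "\<And>k s. 0 < k \<Longrightarrow> 0 < s \<Longrightarrow>
      prob_space.expectation M (\<lambda>\<omega>. exp (- k * Y s \<omega>)) = exp (- s * k powr \<beta>)"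
    using Y by (auto simp: stable_subordinator_def)
  interpret prob_space M using lev by (simp add: levy_process_def)
  have meas[measurable]: "Y t \<in> borel_measurable M" if "0 \<le> t" for t
    using lev that by (simp add: levy_process_def)
  have Y0: "AE \<omega> in M. Y 0 \<omega> = 0" using lev by (simp add: levy_process_def)
  have rc: "AE \<omega> in M. \<forall>t\<ge>0. ((\<lambda>t. Y t \<omega>) \<longlongrightarrow> Y t \<omega>) (at_right t)"
    using lev by (auto simp: levy_process_def cadlag_def continuous_within)
  have nonneg: "AE \<omega> in M. 0 \<le> Y t \<omega>" if t: "0 < t" for t
  proof -
    have "AE \<omega> in M. - (1 / Suc n) < Y t \<omega>" for n
    proof -
      let ?e = "1 / real (Suc n)"
      let ?A = "{\<omega> \<in> space M. Y t \<omega> \<le> - ?e}"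
      \<comment> \<open>The transform is at most \<open>1\<close> for every parameter, so the bound
        vanishes as \<open>k\<close> grows.\<close>
      have "prob ?A \<le> exp (- (real (Suc k) * ?e))" for k
      proof -
        have "prob ?A \<le> exp (real (Suc k) * - ?e) * expectation (\<lambda>\<omega>. exp (- real (Suc k) * Y t \<omega>))"
          using t by (intro Chernoff_exp_neg int) auto
        also have "\<dots> \<le> exp (real (Suc k) * - ?e) * 1"
          using t by (subst tf) (auto intro!: mult_left_mono)
        finally show ?thesis by simp
      qed
      moreover have "(\<lambda>k. exp (- (real (Suc k) * ?e))) \<longlonglongrightarrow> 0"
      proof -
        have "(\<lambda>k. exp (- ?e) ^ Suc k) \<longlonglongrightarrow> 0"
          by (intro LIMSEQ_Suc LIMSEQ_power_zero) auto
        then show ?thesis by (simp only: exp_of_nat_mult[symmetric] mult_minus_right)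
      qed
      ultimately have "prob ?A \<le> 0" by (intro LIMSEQ_le_const) auto
      then have "prob ?A = 0" using measure_nonneg[of M ?A] by linarith
      moreover have "?A \<in> events" using t by auto
      ultimately have "AE \<omega> in M. \<omega> \<notin> ?A" by (simp add: prob_eq_0)
      with AE_space show ?thesis by eventually_elim auto
    qed
    then have "AE \<omega> in M. \<forall>n. - (1 / Suc n) < Y t \<omega>" by (simp add: AE_all_countable)
    then show ?thesis
    proof eventually_elim
      case (elim \<omega>)
      have "(\<lambda>n. - (1 / real (Suc n))) \<longlonglongrightarrow> - 0"
        by (intro tendsto_minus LIMSEQ_Suc[OF lim_1_over_n])
      with elim show ?case by (intro LIMSEQ_le_const2[of _ 0]) (auto intro: less_imp_le)
    qed
  qed
  have incr: "AE \<omega> in M. Y s \<omega> \<le> Y t \<omega>" if st: "0 \<le> s" "s < t" for s t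
  proof -
    have "distr M borel (\<lambda>\<omega>. Y (s + (t - s)) \<omega> - Y s \<omega>) = distr M borel (Y (t - s))"
      using lev st unfolding levy_process_def by (metis diff_ge_0_iff_ge less_imp_le)
    then have eq: "distr M borel (\<lambda>\<omega>. Y t \<omega> - Y s \<omega>) = distr M borel (Y (t - s))" by simp
    have "AE x in distr M borel (Y (t - s)). 0 \<le> x"
      using nonneg[of "t - s"] st by (subst AE_distr_iff) auto
    then show ?thesis unfolding eq[symmetric] using st by (subst (asm) AE_distr_iff) auto
  qed
  have rat: "AE \<omega> in M. \<forall>s\<in>\<rat>. \<forall>t\<in>\<rat>. 0 \<le> s \<longrightarrow> s < t \<longrightarrow> Y s \<omega> \<le> Y t \<omega>"
    by (subst AE_ball_countable[OF countable_rat])+ (use incr in auto)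
  have unb: "AE \<omega> in M. \<forall>v::nat. \<exists>n::nat. real v < Y (Suc n) \<omega>"
  proof (subst AE_all_countable, rule)
    fix v :: nat
    let ?A = "\<lambda>n. {\<omega> \<in> space M. Y (Suc n) \<omega> \<le> real v}"
    let ?B = "{\<omega> \<in> space M. \<forall>n. Y (real (Suc n)) \<omega> \<le> real v}"
    have B: "?B \<in> events" by measurable
    \<comment> \<open>At parameter \<open>1\<close> and time \<open>n + 1\<close> the transform
      equals \<open>exp (- (n + 1))\<close>, while the threshold \<open>v\<close> stays
      fixed.\<close>
    have "prob ?B \<le> exp (real v) * exp (- real (Suc n))" for n
    proof -
      have "prob ?B \<le> prob (?A n)" by (intro finite_measure_mono) auto
      also have "\<dots> \<le> exp (1 * real v) * expectation (\<lambda>\<omega>. exp (- 1 * Y (Suc n) \<omega>))"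
        using int[of 1 "real (Suc n)"] by (intro Chernoff_exp_neg) auto
      also have "\<dots> = exp (real v) * exp (- real (Suc n))" by (subst tf) auto
      finally show ?thesis .
    qed
    moreover have lim: "(\<lambda>n. exp (real v) * exp (- real (Suc n))) \<longlonglongrightarrow> exp (real v) * 0"
      by (intro tendsto_mult tendsto_const filterlim_compose[OF exp_at_bot])
        (simp only: filterlim_uminus_at_top[symmetric], intro filterlim_compose[OF filterlim_real_sequentially filterlim_Suc])
    ultimately have "prob ?B \<le> 0" using LIMSEQ_le_const[OF lim] by auto
    then have "prob ?B = 0" using measure_nonneg[of M ?B] by linarith
    with B have "AE \<omega> in M. \<omega> \<notin> ?B" by (simp add: prob_eq_0)
    with AE_space show "AE \<omega> in M. \<exists>n. real v < Y (Suc n) \<omega>"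
      by eventually_elim (auto simp: not_le)
  qed
  from Y0 rc rat unb show ?thesis
  proof eventually_elim
    case (elim \<omega>)
    have "\<exists>t\<ge>0. v < Y t \<omega>" for v
    proof -
      obtain m :: nat where "v \<le> real m" using real_arch_simple by blast
      moreover obtain n where "real m < Y (Suc n) \<omega>" using elim(4) by blast
      ultimately show ?thesis by (intro exI[of _ "real (Suc n)"]) linarith
    qed
    then show ?case
      using elim unfolding subord_path_def by (auto intro!: mono_on_rats_imp_mono_on)
  qed
qed

text \<open>The supremum is over rational times only, which makes it jointly measurable in the level and the path.\<close>

definition below :: "real \<Rightarrow> (real \<Rightarrow> real) \<Rightarrow> real" where
  "below v y = (SUP q\<in>{q\<in>\<rat>. 0 \<le> q}. if y q < v then y q else 0)"

lemma below_bdd_above: "bdd_above ((\<lambda>q. if y q < v then y q else (0::real)) ` A)"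
  by (rule bdd_aboveI[of _ "max v 0"]) auto

lemma measurable_below:
  assumes p: "\<And>q. 0 \<le> q \<Longrightarrow> (\<lambda>\<omega>. p \<omega> q) \<in> borel_measurable M"
    and v[measurable]: "v \<in> borel_measurable M"
  shows "(\<lambda>\<omega>. below (v \<omega>) (p \<omega>)) \<in> borel_measurable M"
  unfolding below_def
proof (rule borel_measurable_cSUP)
  show "countable {q \<in> \<rat>. 0 \<le> (q::real)}" using countable_rat by (rule countable_subset[rotated]) auto
  show "(\<lambda>\<omega>. if p \<omega> q < v \<omega> then p \<omega> q else 0) \<in> borel_measurable M" if "q \<in> {q \<in> \<rat>. 0 \<le> q}" for q
  proof -
    have [measurable]: "(\<lambda>\<omega>. p \<omega> q) \<in> borel_measurable M" using that p by auto
    show ?thesis by measurable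
  qed
qed (rule below_bdd_above)

lemma below_cong: "(\<And>q. 0 \<le> q \<Longrightarrow> y q = z q) \<Longrightarrow> below v y = below v z"
  unfolding below_def by (intro SUP_cong) auto

text \<open>By right-continuity the path stays below \<open>v\<close> for a while after
  \<open>t\<close>, long enough to meet a rational time. Thus the rational supremum dominates every
  value below \<open>v\<close>.\<close>

lemma below_upper:
  assumes y: "subord_path y" and t: "0 \<le> t" "y t < v"
  shows "\<exists>r>t. y r < v" "y t \<le> below v y"
proof -
  have "\<forall>\<^sub>F u in at_right t. y u < v"
    using y t unfolding subord_path_def by (intro order_tendstoD(2)[of y "y t"]) auto
  then obtain b where b: "t < b" "\<And>u. t < u \<Longrightarrow> u < b \<Longrightarrow> y u < v"
    by (auto simp: eventually_at_right_field)
  obtain q where q: "q \<in> \<rat>" "t < q" "q < b" using Rats_dense_in_real[of t b] b by auto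
  show "\<exists>r>t. y r < v" using b(2)[of q] q by auto
  have "y t \<le> y q" using y t q unfolding subord_path_def by (auto elim!: mono_onD)
  also have "\<dots> = (if y q < v then y q else 0)" using b(2)[of q] q by auto
  also have "\<dots> \<le> below v y"
    unfolding below_def using q t by (intro cSUP_upper below_bdd_above) auto
  finally show "y t \<le> below v y" .
qed

text \<open>The default \<open>0\<close> in the supremum equals \<open>y 0\<close>, itself a value
  below \<open>v\<close> as \<open>v > 0\<close>; so the default never enlarges the
  supremum.\<close>

lemma below_approx:
  assumes y: "subord_path y" and v: "0 < v" and c: "c < below v y"
  shows "\<exists>q\<ge>0. y q < v \<and> c < y q"
proof -
  have "{q \<in> \<rat>. 0 \<le> (q::real)} \<noteq> {}" by (auto intro!: exI[of _ 0])
  then obtain q where q: "0 \<le> q" "c < (if y q < v then y q else 0)"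
    using c less_cSUP_iff[OF _ below_bdd_above, of "{q \<in> \<rat>. 0 \<le> q}"] unfolding below_def by blast
  have "y 0 = 0" using y by (simp add: subord_path_def)
  show ?thesis
  proof (cases "y q < v")
    case True
    then show ?thesis using q by auto
  next
    case False
    then show ?thesis using q v \<open>y 0 = 0\<close> by (intro exI[of _ 0]) auto
  qed
qed

lemma below_bounds:
  assumes y: "subord_path y" and v: "0 < v"
  shows "0 \<le> below v y" "below v y \<le> v"
proof -
  show "0 \<le> below v y" using below_upper(2)[OF y, of 0 v] y v by (simp add: subord_path_def)
  show "below v y \<le> v" using below_approx[OF y v, of v] by (force simp: not_less[symmetric])
qed

text \<open>Right-continuity makes the infimum of the passage times attained, and
  \<open>y 0 = 0 < v\<close> makes it positive. The times before it are exactly those with value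
  strictly below \<open>v\<close>, so by monotonicity the left limit is the supremum of these
  values.\<close>

lemma first_passage:
  assumes y: "subord_path y" and v: "0 < v"
  shows "\<exists>\<sigma>>0. (\<forall>t\<ge>0. v \<le> y t \<longleftrightarrow> \<sigma> \<le> t) \<and> (y \<longlongrightarrow> below v y) (at_left \<sigma>)"
proof -
  have mono: "y s \<le> y t" if "0 \<le> s" "s \<le> t" for s t
    using y that unfolding subord_path_def by (auto elim!: mono_onD)
  define A where "A = {t. 0 \<le> t \<and> v \<le> y t}"
  define \<sigma> where "\<sigma> = Inf A"
  have ne: "A \<noteq> {}" using y unfolding A_def subord_path_def by (blast dest: less_imp_le)
  have bdd: "bdd_below A" unfolding A_def by (auto intro: bdd_belowI[of _ 0])
  have \<sigma>0: "0 \<le> \<sigma>" unfolding \<sigma>_def using ne by (intro cInf_greatest) (auto simp: A_def)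
  have reach: "v \<le> y \<sigma>"
  proof (rule ccontr)
    assume "\<not> v \<le> y \<sigma>"
    then obtain r where r: "\<sigma> < r" "y r < v" using below_upper(1)[OF y \<sigma>0] by force
    then obtain a where a: "a \<in> A" "a < r" using cInf_less_iff[OF ne bdd] unfolding \<sigma>_def by auto
    then have "v \<le> y r" using mono[of a r] by (auto simp: A_def)
    with r show False by simp
  qed
  have iff: "v \<le> y t \<longleftrightarrow> \<sigma> \<le> t" if "0 \<le> t" for t
  proof
    show "\<sigma> \<le> t" if "v \<le> y t" unfolding \<sigma>_def using that \<open>0 \<le> t\<close> by (intro cInf_lower bdd) (auto simp: A_def)
    show "v \<le> y t" if "\<sigma> \<le> t" using reach mono[OF \<sigma>0 that] by simp
  qed
  have "\<sigma> \<noteq> 0" using reach v y by (auto simp: subord_path_def)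
  then have pos: "0 < \<sigma>" using \<sigma>0 by simp
  have "(y \<longlongrightarrow> below v y) (at_left \<sigma>)"
  proof (rule order_tendstoI)
    fix c assume "c < below v y"
    then obtain q where q: "0 \<le> q" "y q < v" "c < y q" using below_approx[OF y v] by blast
    then have "q < \<sigma>" using iff[of q] by auto
    then show "\<forall>\<^sub>F t in at_left \<sigma>. c < y t"
      unfolding eventually_at_left_field
      using q(1,3) mono[of q] by (intro exI[of _ q]) (auto intro: less_le_trans)
  next
    fix c assume c: "below v y < c"
    show "\<forall>\<^sub>F t in at_left \<sigma>. y t < c"
      unfolding eventually_at_left_field
    proof (intro exI[of _ 0] conjI allI impI)
      fix t assume "0 < t" "t < \<sigma>"
      then have "y t \<le> below v y" using iff[of t] by (intro below_upper(2)[OF y]) auto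
      with c show "y t < c" by simp
    qed (rule pos)
  qed
  with pos iff show ?thesis by blast
qed

subsection \<open>The law of the undershoot\<close>

text \<open>
  For a subordinator path and \<open>x > 0\<close> exactly one summand is nonzero. It is \<open>exp (- l u)\<close> for the
  last value \<open>u\<close> below \<open>x\<close> of the path sampled with mesh \<open>h\<close>.
\<close>

definition grid_sum :: "real \<Rightarrow> real \<Rightarrow> (real \<Rightarrow> real) \<Rightarrow> real \<Rightarrow> ennreal" where
  "grid_sum l h y x =
     (\<Sum>n. ennreal (if y (real n * h) < x \<and> x \<le> y (real (Suc n) * h) then exp (- l * y (real n * h)) else 0))"

lemma grid_sum_nonpos: "subord_path y \<Longrightarrow> 0 < h \<Longrightarrow> x \<le> 0 \<Longrightarrow> grid_sum l h y x = 0"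
proof -
  assume y: "subord_path y" and h: "0 < h" "x \<le> 0"
  have "0 \<le> y (real n * h)" for n
    using y h unfolding subord_path_def by (auto dest!: mono_onD[of _ _ 0 "real n * h"])
  then have "\<not> y (real n * h) < x" for n using h by (meson dual_order.trans not_le)
  then show ?thesis by (simp add: grid_sum_def)
qed

lemma grid_sum_pos:
  assumes y: "subord_path y" and h: "0 < h" and x: "0 < x"
  shows "\<exists>n. y (real n * h) < x \<and> x \<le> y (real (Suc n) * h) \<and>
    grid_sum l h y x = ennreal (exp (- l * y (real n * h)))"
proof -
  have mono: "y s \<le> y t" if "0 \<le> s" "s \<le> t" for s t
    using y that unfolding subord_path_def by (auto elim!: mono_onD)
  define k where "k = (LEAST k. x \<le> y (real k * h))"
  have ex: "\<exists>k. x \<le> y (real k * h)"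
  proof -
    obtain t where t: "0 \<le> t" "x < y t" using y unfolding subord_path_def by blast
    obtain k :: nat where "t / h \<le> real k" using real_arch_simple by blast
    then have "t \<le> real k * h" using h by (simp add: field_simps)
    with t mono[of t "real k * h"] show ?thesis by (intro exI[of _ k]) auto
  qed
  have k: "x \<le> y (real k * h)" unfolding k_def using ex by (rule LeastI_ex)
  have less: "y (real i * h) < x" if "i < k" for i
    using not_less_Least[of i "\<lambda>k. x \<le> y (real k * h)"] that unfolding k_def by auto
  have "y (real 0 * h) < x" using x y by (simp add: subord_path_def)
  with k have "k \<noteq> 0" by (metis not_le)
  then obtain n where n: "k = Suc n" using not0_implies_Suc by blast
  let ?f = "\<lambda>n. ennreal (if y (real n * h) < x \<and> x \<le> y (real (Suc n) * h) then exp (- l * y (real n * h)) else 0)"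
  have "?f i = 0" if "i \<notin> {n}" for i
  proof (cases "i < n")
    case True
    then show ?thesis using less[of "Suc i"] n by auto
  next
    case False
    then have "Suc n \<le> i" using that by auto
    then have "y (real (Suc n) * h) \<le> y (real i * h)" using h by (intro mono mult_right_mono) auto
    with k n show ?thesis by auto
  qed
  then have "suminf ?f = sum ?f {n}" by (intro suminf_finite) auto
  with less[of n] k n show ?thesis by (intro exI[of _ n]) (auto simp: grid_sum_def)
qed

lemma grid_sum_le_1:
  assumes "subord_path y" "0 < h" "0 \<le> l"
  shows "grid_sum l h y x \<le> 1"
proof (cases "0 < x")
  case True
  from grid_sum_pos[OF assms(1,2) True] obtain n where
    n: "grid_sum l h y x = ennreal (exp (- l * y (real n * h)))" by blast
  have "0 \<le> y (real n * h)"
    using assms unfolding subord_path_def by (auto dest!: mono_onD[of _ _ 0 "real n * h"])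
  then show ?thesis unfolding n using assms by (simp add: ennreal_le_1)
qed (use assms in \<open>simp add: grid_sum_nonpos\<close>)

text \<open>The sampled value is itself below \<open>x\<close>, hence at most the supremum.
  Conversely, a time \<open>q\<close> whose value is close to the supremum is followed by some
  \<open>r > q\<close> with value still below \<open>x\<close>; once the mesh is smaller than
  \<open>r - q\<close>, the last grid time before the passage is at least \<open>q\<close>.\<close>

lemma grid_sum_tendsto:
  assumes y: "subord_path y" and x: "0 < x"
  shows "(\<lambda>m. grid_sum l (1 / real (Suc m)) y x) \<longlonglongrightarrow> ennreal (exp (- l * below x y))"
proof -
  have mono: "y s \<le> y t" if "0 \<le> s" "s \<le> t" for s t
    using y that unfolding subord_path_def by (auto elim!: mono_onD)
  have "\<exists>n. y (real n * (1 / real (Suc m))) < x \<and> x \<le> y (real (Suc n) * (1 / real (Suc m))) \<and>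
    grid_sum l (1 / real (Suc m)) y x = ennreal (exp (- l * y (real n * (1 / real (Suc m)))))" for m
    by (rule grid_sum_pos[OF y _ x]) auto
  then obtain n where n: "\<And>m. y (real (n m) * (1 / real (Suc m))) < x"
      "\<And>m. x \<le> y (real (Suc (n m)) * (1 / real (Suc m)))"
      "\<And>m. grid_sum l (1 / real (Suc m)) y x = ennreal (exp (- l * y (real (n m) * (1 / real (Suc m)))))"
    by metis
  have "(\<lambda>m. y (real (n m) * (1 / real (Suc m)))) \<longlonglongrightarrow> below x y"
  proof (rule order_tendstoI)
    fix c assume "c < below x y"
    then obtain q where q: "0 \<le> q" "y q < x" "c < y q" using below_approx[OF y x] by blast
    then obtain r where r: "q < r" "y r < x" using below_upper(1)[OF y] by blast
    have "(\<lambda>m. 1 / real (Suc m)) \<longlonglongrightarrow> 0" by (intro LIMSEQ_Suc[OF lim_1_over_n])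
    then have "\<forall>\<^sub>F m in sequentially. 1 / real (Suc m) < r - q"
      using r by (intro order_tendstoD(2)) auto
    then show "\<forall>\<^sub>F m in sequentially. c < y (real (n m) * (1 / real (Suc m)))"
    proof eventually_elim
      case (elim m)
      have "y r < y (real (Suc (n m)) * (1 / real (Suc m)))" using n(2)[of m] r by simp
      then have "r < real (Suc (n m)) * (1 / real (Suc m))"
        using mono[of "real (Suc (n m)) * (1 / real (Suc m))" r] by (force simp: not_le[symmetric])
      also have "\<dots> = real (n m) * (1 / real (Suc m)) + 1 / real (Suc m)" by (simp add: add_divide_distrib)
      finally have "q \<le> real (n m) * (1 / real (Suc m))" using elim by simp
      with q mono[of q] show ?case by (meson less_le_trans)
    qed
  next
    fix c assume c: "below x y < c"
    have "y (real (n m) * (1 / real (Suc m))) \<le> below x y" for m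
      by (rule below_upper(2)[OF y _ n(1)]) auto
    with c show "\<forall>\<^sub>F m in sequentially. y (real (n m) * (1 / real (Suc m))) < c"
      by (intro always_eventually allI) (meson le_less_trans)
  qed
  then show ?thesis unfolding n(3) by (intro tendsto_ennrealI tendsto_intros)
qed

section \<open>Exponential integrals and the double transform of the beta law\<close>

lemma nn_integral_exp_Ioc:
  assumes q: "0 < q" and ab: "a \<le> b"
  shows "(\<integral>\<^sup>+x. ennreal (if a < x \<and> x \<le> b then exp (- q * x) else 0) \<partial>lborel) =
    ennreal ((exp (- q * a) - exp (- q * b)) / q)"
proof -
  have "(\<integral>\<^sup>+x. ennreal (if a < x \<and> x \<le> b then exp (- q * x) else 0) \<partial>lborel) =
    (\<integral>\<^sup>+x. ennreal (exp (- q * x)) * indicator {a..b} x \<partial>lborel)"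
    by (intro nn_integral_cong_AE AE_I[of _ _ "{a}"]) (auto simp: indicator_def)
  also have "\<dots> = ennreal (- exp (- q * b) / q - (- exp (- q * a) / q))"
  proof (rule nn_integral_FTC_Icc)
    show "((\<lambda>x. - exp (- q * x) / q) has_real_derivative exp (- q * x)) (at x)" for x
      using q by (auto intro!: derivative_eq_intros)
  qed (use ab in auto)
  also have "- exp (- q * b) / q - (- exp (- q * a) / q) = (exp (- q * a) - exp (- q * b)) / q"
    by (simp add: diff_divide_distrib)
  finally show ?thesis .
qed

lemma nn_integral_Gamma:
  fixes a q :: real
  assumes a: "0 < a" and q: "0 < q"
  shows "(\<integral>\<^sup>+t. ennreal (if 0 < t then t powr (a - 1) * exp (- q * t) else 0) \<partial>lborel) =
    ennreal (Gamma a * q powr (- a))"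
proof -
  let ?I = "\<integral>\<^sup>+t. ennreal (if 0 < t then t powr (a - 1) * exp (- q * t) else 0) \<partial>lborel"
  have "ennreal (Gamma a) = (\<integral>\<^sup>+t. ennreal (indicator {0..} t * t powr (a - 1) / exp t) \<partial>lborel)"
    by (rule Gamma_conv_nn_integral_real[OF a])
  also have "\<dots> = ennreal \<bar>q\<bar> *
      (\<integral>\<^sup>+t. ennreal (indicator {0..} (0 + q * t) * (0 + q * t) powr (a - 1) / exp (0 + q * t)) \<partial>lborel)"
    using q by (intro nn_integral_real_affine) auto
  also have "\<dots> = ennreal q * (\<integral>\<^sup>+t. ennreal (q powr (a - 1)) *
      ennreal (if 0 < t then t powr (a - 1) * exp (- q * t) else 0) \<partial>lborel)"
    using q
    by (intro arg_cong2[where f = "(*)"] nn_integral_cong_AE AE_I[of _ _ "{0}"])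
      (auto simp: indicator_def powr_mult exp_minus field_simps zero_le_mult_iff ennreal_mult[symmetric])
  also have "\<dots> = ennreal (q * q powr (a - 1)) * ?I"
    using q by (subst nn_integral_cmult) (auto simp: ennreal_mult mult.assoc)
  also have "q * q powr (a - 1) = q powr a" using q by (simp add: powr_diff)
  finally have G: "ennreal (Gamma a) = ennreal (q powr a) * ?I" .
  have "ennreal (Gamma a * q powr (- a)) = ennreal (q powr (- a)) * ennreal (Gamma a)"
    using Gamma_real_pos[OF a] by (simp add: ennreal_mult[symmetric] mult.commute)
  also have "\<dots> = ennreal (q powr (- a) * q powr a) * ?I"
    unfolding G by (simp add: ennreal_mult mult.assoc)
  also have "q powr (- a) * q powr a = 1" using q by (simp add: powr_minus field_simps)
  finally show ?thesis by simp
qed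

text \<open>With \<open>y = x * (1 - r)\<close> the beta density becomes the kernel of a
  convolution. Writing \<open>x = y + z\<close>, the weight splits into
  \<open>exp (- (l + q) * y)\<close> and \<open>exp (- q * z)\<close>; the two Gamma integrals then
  cancel the normalising constant.\<close>

lemma beta_law_laplace:
  assumes \<beta>: "0 < \<beta>" "\<beta> < 1" and q: "0 < q" and l: "0 \<le> l"
  shows "(\<integral>\<^sup>+x. ennreal (if 0 < x then exp (- q * x) else 0) *
      (\<integral>\<^sup>+r. ennreal (beta_dens \<beta> r) * ennreal (exp (- l * (x * (1 - r)))) \<partial>lborel) \<partial>lborel) =
    ennreal (q powr (\<beta> - 1) * (l + q) powr (- \<beta>))"
proof -
  define D where "D = Gamma \<beta> * Gamma (1 - \<beta>)"
  have D: "0 < D" using \<beta> by (simp add: D_def Gamma_real_pos)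
  have inner: "(\<integral>\<^sup>+r. ennreal (beta_dens \<beta> r) * ennreal (exp (- l * (x * (1 - r)))) \<partial>lborel) =
    (\<integral>\<^sup>+y. ennreal (if 0 < y \<and> y < x then y powr (\<beta> - 1) * (x - y) powr (- \<beta>) * exp (- l * y) / D else 0) \<partial>lborel)"
    if x: "0 < x" for x
  proof -
    have "(\<integral>\<^sup>+r. ennreal (beta_dens \<beta> r) * ennreal (exp (- l * (x * (1 - r)))) \<partial>lborel) =
      ennreal \<bar>- 1 / x\<bar> * (\<integral>\<^sup>+y. ennreal (beta_dens \<beta> (1 + - 1 / x * y)) *
        ennreal (exp (- l * (x * (1 - (1 + - 1 / x * y))))) \<partial>lborel)"
      \<comment> \<open>The substitution is \<open>r = 1 - y / x\<close>, whose Jacobian is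
        \<open>1 / x\<close>.\<close>
      using x by (intro nn_integral_real_affine) (auto simp: beta_dens_def)
    also have "\<dots> = (\<integral>\<^sup>+y. ennreal (1 / x) * (ennreal (beta_dens \<beta> (1 + - 1 / x * y)) *
        ennreal (exp (- l * (x * (1 - (1 + - 1 / x * y)))))) \<partial>lborel)"
      using x by (subst nn_integral_cmult) (auto simp: beta_dens_def)
    also have "\<dots> = (\<integral>\<^sup>+y. ennreal (if 0 < y \<and> y < x then y powr (\<beta> - 1) * (x - y) powr (- \<beta>) * exp (- l * y) / D else 0) \<partial>lborel)"
    proof (rule nn_integral_cong)
      fix y
      have dens: "1 / x * beta_dens \<beta> (1 + - 1 / x * y) =
        (if 0 < y \<and> y < x then y powr (\<beta> - 1) * (x - y) powr (- \<beta>) / D else 0)"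
      proof (cases "0 < y \<and> y < x")
        case True
        have "beta_dens \<beta> (1 + - 1 / x * y) = (y / x) powr (\<beta> - 1) * ((x - y) / x) powr (- \<beta>) / D"
          using x True by (auto simp: beta_dens_def D_def field_simps)
        also have "\<dots> = y powr (\<beta> - 1) * (x - y) powr (- \<beta>) / D * (x powr (1 - \<beta>) * x powr \<beta>)"
          using x True D by (simp add: powr_divide powr_diff powr_minus field_simps)
        also have "x powr (1 - \<beta>) * x powr \<beta> = x" using x by (simp add: powr_add[symmetric])
        finally show ?thesis using True x by simp
      next
        case False
        then show ?thesis using x by (auto simp: beta_dens_def field_simps)
      qed
      have "ennreal (1 / x) * (ennreal (beta_dens \<beta> (1 + - 1 / x * y)) * ennreal (exp (- l * y))) =
        ennreal (1 / x * beta_dens \<beta> (1 + - 1 / x * y) * exp (- l * y))"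
        using x \<beta> by (simp add: ennreal_mult'[symmetric] ennreal_mult''[symmetric] mult.assoc)
      also have "\<dots> = ennreal (if 0 < y \<and> y < x then y powr (\<beta> - 1) * (x - y) powr (- \<beta>) * exp (- l * y) / D else 0)"
        unfolding dens by auto
      finally show "ennreal (1 / x) * (ennreal (beta_dens \<beta> (1 + - 1 / x * y)) *
          ennreal (exp (- l * (x * (1 - (1 + - 1 / x * y)))))) = \<dots>"
        using x by simp
    qed
    finally show ?thesis .
  qed
  let ?F = "\<lambda>x y. ennreal (if 0 < y \<and> y < x then y powr (\<beta> - 1) * (x - y) powr (- \<beta>) * exp (- l * y) / D * exp (- q * x) else 0)"
  have "(\<integral>\<^sup>+x. ennreal (if 0 < x then exp (- q * x) else 0) *
      (\<integral>\<^sup>+r. ennreal (beta_dens \<beta> r) * ennreal (exp (- l * (x * (1 - r)))) \<partial>lborel) \<partial>lborel) =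
    (\<integral>\<^sup>+x. \<integral>\<^sup>+y. ?F x y \<partial>lborel \<partial>lborel)"
  proof (rule nn_integral_cong)
    fix x :: real
    show "ennreal (if 0 < x then exp (- q * x) else 0) *
      (\<integral>\<^sup>+r. ennreal (beta_dens \<beta> r) * ennreal (exp (- l * (x * (1 - r)))) \<partial>lborel) = (\<integral>\<^sup>+y. ?F x y \<partial>lborel)"
    proof (cases "0 < x")
      case True
      show ?thesis unfolding inner[OF True] using True D
        by (subst nn_integral_cmult[symmetric])
          (auto intro!: nn_integral_cong simp: ennreal_mult[symmetric] mult.commute)
    next
      case False
      then have "?F x y = 0" for y by auto
      then show ?thesis using False by simp
    qed
  qed
  also have "\<dots> = (\<integral>\<^sup>+y. \<integral>\<^sup>+x. ?F x y \<partial>lborel \<partial>lborel)"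
    by (rule lborel_pair.Fubini') measurable
  also have "\<dots> = (\<integral>\<^sup>+y. ennreal (if 0 < y then y powr (\<beta> - 1) * exp (- (l + q) * y) else 0) *
      ennreal (Gamma (1 - \<beta>) * q powr (\<beta> - 1) / D) \<partial>lborel)"
  proof (rule nn_integral_cong)
    fix y :: real
    show "(\<integral>\<^sup>+x. ?F x y \<partial>lborel) = ennreal (if 0 < y then y powr (\<beta> - 1) * exp (- (l + q) * y) else 0) *
      ennreal (Gamma (1 - \<beta>) * q powr (\<beta> - 1) / D)"
    proof (cases "0 < y")
      case True
      let ?c = "y powr (\<beta> - 1) * exp (- (l + q) * y) / D"
      have "(\<integral>\<^sup>+x. ?F x y \<partial>lborel) = ennreal \<bar>1\<bar> * (\<integral>\<^sup>+z. ?F (y + 1 * z) y \<partial>lborel)"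
        by (rule nn_integral_real_affine) auto
      also have "\<dots> = (\<integral>\<^sup>+z. ennreal ?c * ennreal (if 0 < z then z powr ((1 - \<beta>) - 1) * exp (- q * z) else 0) \<partial>lborel)"
        using True D
        by (auto intro!: nn_integral_cong simp: ennreal_mult[symmetric] exp_add[symmetric] algebra_simps exp_minus exp_diff)
      also have "\<dots> = ennreal ?c * ennreal (Gamma (1 - \<beta>) * q powr (- (1 - \<beta>)))"
        using \<beta> q by (subst nn_integral_cmult) (auto simp: nn_integral_Gamma)
      also have "\<dots> = ennreal (y powr (\<beta> - 1) * exp (- (l + q) * y)) * ennreal (Gamma (1 - \<beta>) * q powr (\<beta> - 1) / D)"
        using D \<beta> Gamma_real_pos[of "1 - \<beta>"] by (simp add: ennreal_mult[symmetric])
      finally show ?thesis using True by simp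
    next
      case False
      then have "?F x y = 0" for x by auto
      then show ?thesis using False by simp
    qed
  qed
  also have "\<dots> = ennreal (Gamma \<beta> * (l + q) powr (- \<beta>)) * ennreal (Gamma (1 - \<beta>) * q powr (\<beta> - 1) / D)"
    using \<beta> q l by (subst nn_integral_multc) (auto simp: nn_integral_Gamma)
  also have "\<dots> = ennreal (q powr (\<beta> - 1) * (l + q) powr (- \<beta>))"
  proof -
    have "0 < Gamma \<beta>" "0 < Gamma (1 - \<beta>)" using \<beta> by (auto intro: Gamma_real_pos)
    then show ?thesis by (simp add: ennreal_mult[symmetric] D_def mult.commute)
  qed
  finally show ?thesis .
qed

section \<open>Transforms of the sampled subordinator\<close>

lemma stable_subordinator_laplace:
  assumes Y: "stable_subordinator M \<beta> Y" and k: "0 < k" and s: "0 \<le> s"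
  shows "integrable M (\<lambda>\<omega>. exp (- k * Y s \<omega>))"
    "(\<integral>\<omega>. exp (- k * Y s \<omega>) \<partial>M) = exp (- s * k powr \<beta>)"
proof -
  have lev: "levy_process M Y" using Y by (simp add: stable_subordinator_def)
  interpret prob_space M using lev by (simp add: levy_process_def)
  have [measurable]: "Y s \<in> borel_measurable M" using lev s by (simp add: levy_process_def)
  \<comment> \<open>Time \<open>0\<close> is the first grid point; the process vanishes there only
    almost surely.\<close>
  have 0: "AE \<omega> in M. exp (- k * Y s \<omega>) = 1" if "s = 0"
    using lev that by (auto simp: levy_process_def)
  show "integrable M (\<lambda>\<omega>. exp (- k * Y s \<omega>))"
  proof (cases "s = 0")
    case True
    from 0[OF True] have "integrable M (\<lambda>\<omega>. exp (- k * Y s \<omega>)) \<longleftrightarrow> integrable M (\<lambda>_. 1::real)"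
      by (intro integrable_cong_AE) auto
    then show ?thesis by simp
  qed (use Y k s in \<open>auto simp: stable_subordinator_def\<close>)
  show "(\<integral>\<omega>. exp (- k * Y s \<omega>) \<partial>M) = exp (- s * k powr \<beta>)"
  proof (cases "s = 0")
    case True
    from 0[OF True] have "(\<integral>\<omega>. exp (- k * Y s \<omega>) \<partial>M) = (\<integral>\<omega>. 1 \<partial>M)"
      by (intro integral_cong_AE) auto
    then show ?thesis using True by (simp add: prob_space)
  qed (use Y k s in \<open>auto simp: stable_subordinator_def\<close>)
qed

text \<open>The exponent is regrouped as \<open>(l + q) * Y s\<close> plus \<open>q\<close> times
  the increment over \<open>h\<close>; the two parts are independent.\<close>

lemma stable_subordinator_laplace2:
  assumes Y: "stable_subordinator M \<beta> Y" and l: "0 \<le> l" and q: "0 < q" and s: "0 \<le> s" and h: "0 < h"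
  shows "integrable M (\<lambda>\<omega>. exp (- l * Y s \<omega>) * exp (- q * Y (s + h) \<omega>))"
    "(\<integral>\<omega>. exp (- l * Y s \<omega>) * exp (- q * Y (s + h) \<omega>) \<partial>M) =
      exp (- s * (l + q) powr \<beta>) * exp (- h * q powr \<beta>)"
proof -
  have lev: "levy_process M Y" using Y by (simp add: stable_subordinator_def)
  interpret prob_space M using lev by (simp add: levy_process_def)
  have meas[measurable]: "Y s \<in> borel_measurable M" "Y 0 \<in> borel_measurable M"
    "Y (s + h) \<in> borel_measurable M" "Y h \<in> borel_measurable M"
    using lev s h by (auto simp: levy_process_def)
  have Y0: "AE \<omega> in M. Y 0 \<omega> = 0" using lev by (simp add: levy_process_def)
  let ?Z = "\<lambda>\<omega>. Y (s + h) \<omega> - Y s \<omega>"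
  have dZ: "distr M borel ?Z = distr M borel (Y h)" using lev s h by (simp add: levy_process_def)
  have "integrable (distr M borel (Y h)) (\<lambda>z. exp (- q * z))"
    using stable_subordinator_laplace(1)[OF Y q] h by (subst integrable_distr_eq) auto
  then have iZ: "integrable M (\<lambda>\<omega>. exp (- q * ?Z \<omega>))"
    unfolding dZ[symmetric] by (subst (asm) integrable_distr_eq) auto
  have "(\<integral>\<omega>. exp (- q * ?Z \<omega>) \<partial>M) = (\<integral>z. exp (- q * z) \<partial>distr M borel ?Z)"
    by (subst integral_distr) auto
  also have "\<dots> = (\<integral>\<omega>. exp (- q * Y h \<omega>) \<partial>M)" unfolding dZ by (subst integral_distr) auto
  finally have eZ: "(\<integral>\<omega>. exp (- q * ?Z \<omega>) \<partial>M) = exp (- h * q powr \<beta>)"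
    using stable_subordinator_laplace(2)[OF Y q] h by simp
  define k where "k = l + q"
  have split: "exp (- l * Y s \<omega>) * exp (- q * Y (s + h) \<omega>) = exp (- k * Y s \<omega>) * exp (- q * ?Z \<omega>)" for \<omega>
    by (simp add: k_def exp_add[symmetric] algebra_simps)
  have lq: "0 < k" using l q by (simp add: k_def)
  have "integrable M (\<lambda>\<omega>. exp (- k * Y s \<omega>) * exp (- q * ?Z \<omega>)) \<and>
    (\<integral>\<omega>. exp (- k * Y s \<omega>) * exp (- q * ?Z \<omega>) \<partial>M) =
      exp (- s * k powr \<beta>) * exp (- h * q powr \<beta>)"
  \<comment> \<open>Independence of increments is stated for strictly increasing time points, and
    \<open>0\<close>, \<open>s\<close>, \<open>s + h\<close> are such only if \<open>s > 0\<close>.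
    For \<open>s = 0\<close> the first factor is almost surely \<open>1\<close>.\<close>
  proof (cases "s = 0")
    case True
    have AE1: "AE \<omega> in M. exp (- k * Y s \<omega>) * exp (- q * ?Z \<omega>) = exp (- q * ?Z \<omega>)"
      using Y0 True by auto
    have "integrable M (\<lambda>\<omega>. exp (- k * Y s \<omega>) * exp (- q * ?Z \<omega>)) \<longleftrightarrow> integrable M (\<lambda>\<omega>. exp (- q * ?Z \<omega>))"
      using AE1 by (intro integrable_cong_AE) auto
    moreover have "(\<integral>\<omega>. exp (- k * Y s \<omega>) * exp (- q * ?Z \<omega>) \<partial>M) = (\<integral>\<omega>. exp (- q * ?Z \<omega>) \<partial>M)"
      using AE1 by (intro integral_cong_AE) auto
    ultimately show ?thesis using iZ eZ True by simp
  next
    case False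
    define t where "t i = (if i = 0 then 0 else if i = Suc 0 then s else s + h)" for i :: nat
    have "0 \<le> t 0 \<and> (\<forall>i<2. t i < t (Suc i))"
      using False s h by (auto simp: t_def less_Suc_eq numeral_2_eq_2)
    then have "indep_vars (\<lambda>_. borel) (\<lambda>i \<omega>. Y (t (Suc i)) \<omega> - Y (t i) \<omega>) {..<2}"
      using lev unfolding levy_process_def by blast
    then have ind: "indep_vars (\<lambda>_. borel)
        (\<lambda>i \<omega>. (\<lambda>i v. exp (- (if i = 0 then k else q) * v)) i (Y (t (Suc i)) \<omega> - Y (t i) \<omega>)) {..<2}"
      by (rule indep_vars_compose2) auto
    have AE0: "AE \<omega> in M. exp (- k * (Y s \<omega> - Y 0 \<omega>)) = exp (- k * Y s \<omega>)" using Y0 by auto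
    have i0: "integrable M (\<lambda>\<omega>. exp (- k * (Y s \<omega> - Y 0 \<omega>)))"
      using integrable_cong_AE[OF _ _ AE0] stable_subordinator_laplace(1)[OF Y lq s] by simp
    have e0: "(\<integral>\<omega>. exp (- k * (Y s \<omega> - Y 0 \<omega>)) \<partial>M) = exp (- s * k powr \<beta>)"
      using integral_cong_AE[OF _ _ AE0] stable_subordinator_laplace(2)[OF Y lq s] by simp
    have int: "integrable M (\<lambda>\<omega>. (\<lambda>i v. exp (- (if i = 0 then k else q) * v)) i (Y (t (Suc i)) \<omega> - Y (t i) \<omega>))"
      if "i \<in> {..<2}" for i
      using that i0 iZ by (auto simp: t_def less_Suc_eq numeral_2_eq_2)
    have prod: "(\<Prod>i<2. exp (- (if i = 0 then k else q) * (Y (t (Suc i)) \<omega> - Y (t i) \<omega>))) =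
        exp (- k * (Y s \<omega> - Y 0 \<omega>)) * exp (- q * ?Z \<omega>)" for \<omega>
      by (simp add: numeral_2_eq_2 t_def)
    have AE2: "AE \<omega> in M. exp (- k * Y s \<omega>) * exp (- q * ?Z \<omega>) =
        exp (- k * (Y s \<omega> - Y 0 \<omega>)) * exp (- q * ?Z \<omega>)"
      using Y0 by auto
    have "integrable M (\<lambda>\<omega>. exp (- k * (Y s \<omega> - Y 0 \<omega>)) * exp (- q * ?Z \<omega>))"
      using indep_vars_integrable[OF _ ind int] unfolding prod by simp
    moreover have "(\<integral>\<omega>. exp (- k * (Y s \<omega> - Y 0 \<omega>)) * exp (- q * ?Z \<omega>) \<partial>M) =
        exp (- s * k powr \<beta>) * exp (- h * q powr \<beta>)"
      using indep_vars_lebesgue_integral[OF _ ind int] e0 eZ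
      unfolding prod by (simp add: numeral_2_eq_2 t_def)
    ultimately show ?thesis using integrable_cong_AE[OF _ _ AE2] integral_cong_AE[OF _ _ AE2] by simp
  qed
  then show "integrable M (\<lambda>\<omega>. exp (- l * Y s \<omega>) * exp (- q * Y (s + h) \<omega>))"
    "(\<integral>\<omega>. exp (- l * Y s \<omega>) * exp (- q * Y (s + h) \<omega>) \<partial>M) =
      exp (- s * (l + q) powr \<beta>) * exp (- h * q powr \<beta>)"
    unfolding split k_def[symmetric] by auto
qed

text \<open>The level integral over one step of the sampled path is a difference of exponentials, so
  each expectation involves only two successive grid values. The ratio of the resulting series is
  \<open>exp (- h * (l + q) powr \<beta>)\<close>, which is below \<open>1\<close> as
  \<open>l + q > 0\<close>.\<close>

lemma nn_integral_grid_sum: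
  assumes Y: "stable_subordinator M \<beta> Y" and l: "0 \<le> l" and q: "0 < q" and h: "0 < h"
  shows "(\<integral>\<^sup>+\<omega>. \<integral>\<^sup>+x. grid_sum l h (\<lambda>t. Y t \<omega>) x * ennreal (exp (- q * x)) \<partial>lborel \<partial>M) =
    ennreal ((1 - exp (- h * q powr \<beta>)) / (q * (1 - exp (- h * (l + q) powr \<beta>))))"
proof -
  have lev: "levy_process M Y" using Y by (simp add: stable_subordinator_def)
  interpret prob_space M using lev by (simp add: levy_process_def)
  have [measurable]: "Y (real n * h) \<in> borel_measurable M" for n
    using lev h by (auto simp: levy_process_def)
  let ?y = "\<lambda>n \<omega>. Y (real n * h) \<omega>"
  let ?c = "\<lambda>n \<omega>. exp (- l * ?y n \<omega>) * ((exp (- q * ?y n \<omega>) - exp (- q * ?y (Suc n) \<omega>)) / q)"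
  have good: "AE \<omega> in M. subord_path (\<lambda>t. Y t \<omega>)" by (rule stable_subordinator_AE_subord_path[OF Y])
  have mono: "?y n \<omega> \<le> ?y (Suc n) \<omega>" if "subord_path (\<lambda>t. Y t \<omega>)" for n \<omega>
    using that h unfolding subord_path_def by (auto elim!: mono_onD intro!: mult_right_mono)
  have "(\<integral>\<^sup>+\<omega>. \<integral>\<^sup>+x. grid_sum l h (\<lambda>t. Y t \<omega>) x * ennreal (exp (- q * x)) \<partial>lborel \<partial>M) =
    (\<integral>\<^sup>+\<omega>. (\<Sum>n. ennreal (?c n \<omega>)) \<partial>M)"
  proof (rule nn_integral_cong_AE, use good in eventually_elim)
    case (elim \<omega>)
    have "(\<integral>\<^sup>+x. grid_sum l h (\<lambda>t. Y t \<omega>) x * ennreal (exp (- q * x)) \<partial>lborel) =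
      (\<integral>\<^sup>+x. (\<Sum>n. ennreal (exp (- l * ?y n \<omega>)) *
        ennreal (if ?y n \<omega> < x \<and> x \<le> ?y (Suc n) \<omega> then exp (- q * x) else 0)) \<partial>lborel)"
      unfolding grid_sum_def ennreal_suminf_multc[symmetric]
      by (intro nn_integral_cong arg_cong[where f = suminf] ext) (auto simp: ennreal_mult[symmetric])
    also have "\<dots> = (\<Sum>n. ennreal (exp (- l * ?y n \<omega>)) *
        ennreal ((exp (- q * ?y n \<omega>) - exp (- q * ?y (Suc n) \<omega>)) / q))"
      by (subst nn_integral_suminf, measurable)
        (subst nn_integral_cmult, measurable, subst nn_integral_exp_Ioc[OF q mono[OF elim]], simp)
    also have "\<dots> = (\<Sum>n. ennreal (?c n \<omega>))"
      by (intro arg_cong[where f = suminf] ext ennreal_mult'[symmetric]) simp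
    finally show ?case .
  qed
  also have "\<dots> = (\<Sum>n. \<integral>\<^sup>+\<omega>. ennreal (?c n \<omega>) \<partial>M)" by (rule nn_integral_suminf) measurable
  also have "\<dots> = (\<Sum>n. ennreal (exp (- h * (l + q) powr \<beta>) ^ n * ((1 - exp (- h * q powr \<beta>)) / q)))"
  proof (intro arg_cong[where f = suminf] ext)
    fix n
    have s: "0 \<le> real n * h" "real n * h + h = real (Suc n) * h" using h by (auto simp: algebra_simps)
    have lq: "0 < l + q" using l q by simp
    note i1 = stable_subordinator_laplace[OF Y lq s(1)]
    note i2 = stable_subordinator_laplace2[OF Y l q s(1) h, unfolded s(2)]
    have c: "?c n = (\<lambda>\<omega>. (exp (- (l + q) * ?y n \<omega>) - exp (- l * ?y n \<omega>) * exp (- q * ?y (Suc n) \<omega>)) / q)"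
      by (simp add: algebra_simps exp_add[symmetric] fun_eq_iff)
    have int: "integrable M (?c n)" unfolding c using i1(1) i2(1) by simp
    have "(\<integral>\<omega>. ?c n \<omega> \<partial>M) =
        (exp (- (real n * h) * (l + q) powr \<beta>) - exp (- (real n * h) * (l + q) powr \<beta>) * exp (- h * q powr \<beta>)) / q"
      unfolding c using i1 i2 by simp
    also have "\<dots> = exp (- h * (l + q) powr \<beta>) ^ n * ((1 - exp (- h * q powr \<beta>)) / q)"
      by (simp add: exp_of_nat_mult[symmetric] algebra_simps diff_divide_distrib)
    finally have e: "(\<integral>\<omega>. ?c n \<omega> \<partial>M) = \<dots>" .
    \<comment> \<open>Sampled paths increase, so the Bochner expectation just computed is also the
      nonnegative integral.\<close>
    have "AE \<omega> in M. 0 \<le> ?c n \<omega>" using good by eventually_elim (use mono q in auto)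
    then show "(\<integral>\<^sup>+\<omega>. ennreal (?c n \<omega>) \<partial>M) = ennreal (exp (- h * (l + q) powr \<beta>) ^ n * ((1 - exp (- h * q powr \<beta>)) / q))"
      using nn_integral_eq_integral[OF int] unfolding e by simp
  qed
  also have "\<dots> = ennreal (1 / (1 - exp (- h * (l + q) powr \<beta>)) * ((1 - exp (- h * q powr \<beta>)) / q))"
  proof (rule suminf_ennreal_eq)
    show "0 \<le> exp (- h * (l + q) powr \<beta>) ^ n * ((1 - exp (- h * q powr \<beta>)) / q)" for n
      using q h by simp
    show "(\<lambda>n. exp (- h * (l + q) powr \<beta>) ^ n * ((1 - exp (- h * q powr \<beta>)) / q)) sums
      (1 / (1 - exp (- h * (l + q) powr \<beta>)) * ((1 - exp (- h * q powr \<beta>)) / q))"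
      using q h l by (intro sums_mult2 geometric_sums) simp
  qed
  finally show ?thesis by (simp add: mult.commute)
qed

text \<open>Numerator and denominator, divided by the mesh, are difference quotients of exponentials
  at \<open>0\<close>.\<close>

lemma one_minus_exp_quotient_tendsto:
  fixes a b :: real
  assumes b: "b \<noteq> 0"
  shows "(\<lambda>m. (1 - exp (- (1 / real (Suc m)) * a)) / (1 - exp (- (1 / real (Suc m)) * b))) \<longlonglongrightarrow> a / b"
proof -
  have lim: "(\<lambda>m. (exp (- (1 / real (Suc m)) * c) - 1) / (1 / real (Suc m))) \<longlonglongrightarrow> - c" for c
  proof -
    have "((\<lambda>h. exp (- h * c)) has_real_derivative - c) (at 0)"
      by (auto intro!: derivative_eq_intros)
    then have "((\<lambda>h. (exp (- h * c) - 1) / h) \<longlongrightarrow> - c) (at 0)"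
      by (simp add: has_field_derivative_iff)
    moreover have "filterlim (\<lambda>m. 1 / real (Suc m)) (at 0) sequentially"
      by (intro filterlim_atI LIMSEQ_Suc[OF lim_1_over_n]) auto
    ultimately show ?thesis by (rule filterlim_compose)
  qed
  have "(\<lambda>m. ((exp (- (1 / real (Suc m)) * a) - 1) / (1 / real (Suc m))) /
      ((exp (- (1 / real (Suc m)) * b) - 1) / (1 / real (Suc m)))) \<longlonglongrightarrow> (- a) / (- b)"
    using b by (intro tendsto_divide lim) auto
  moreover have "(\<lambda>m. ((exp (- (1 / real (Suc m)) * a) - 1) / (1 / real (Suc m))) /
      ((exp (- (1 / real (Suc m)) * b) - 1) / (1 / real (Suc m)))) =
    (\<lambda>m. (1 - exp (- (1 / real (Suc m)) * a)) / (1 - exp (- (1 / real (Suc m)) * b)))"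
  proof
    have quot: "((E - 1) / d) / ((F - 1) / d) = (1 - E) / (1 - F)" if "d \<noteq> 0" for d E F :: real
      using that minus_divide_divide[of "E - 1" "F - 1"] by simp
    show "((exp (- (1 / real (Suc m)) * a) - 1) / (1 / real (Suc m))) /
        ((exp (- (1 / real (Suc m)) * b) - 1) / (1 / real (Suc m))) =
      (1 - exp (- (1 / real (Suc m)) * a)) / (1 - exp (- (1 / real (Suc m)) * b))" for m
      by (rule quot) simp
  qed
  ultimately show ?thesis by simp
qed

text \<open>The mesh tends to zero along \<open>1 / (m + 1)\<close>. Convergence is dominated twice,
  in the level by \<open>exp (- q * x)\<close> because the grid sum is at most \<open>1\<close>, and
  then over the probability space by the integral of that function.\<close>

lemma subordinator_below_laplace:
  assumes Y: "stable_subordinator M \<beta> Y" and l: "0 \<le> l" and q: "0 < q"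
  shows "(\<integral>\<^sup>+x. ennreal (if 0 < x then exp (- q * x) else 0) *
      (\<integral>\<^sup>+\<omega>. ennreal (exp (- l * below x (\<lambda>t. Y t \<omega>))) \<partial>M) \<partial>lborel) =
    ennreal (q powr (\<beta> - 1) * (l + q) powr (- \<beta>))"
proof -
  have lev: "levy_process M Y" using Y by (simp add: stable_subordinator_def)
  interpret prob_space M using lev by (simp add: levy_process_def)
  interpret P: pair_sigma_finite M lborel ..
  have meas: "Y t \<in> borel_measurable M" if "0 \<le> t" for t
    using lev that by (simp add: levy_process_def)
  have good: "AE \<omega> in M. subord_path (\<lambda>t. Y t \<omega>)" by (rule stable_subordinator_AE_subord_path[OF Y])
  have [measurable]: "(\<lambda>(\<omega>, x). below x (\<lambda>t. Y t \<omega>)) \<in> borel_measurable (M \<Otimes>\<^sub>M lborel)"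
    unfolding split_beta' by (intro measurable_below measurable_compose[OF measurable_fst meas]) auto
  let ?u = "\<lambda>m \<omega> x. grid_sum l (1 / real (Suc m)) (\<lambda>t. Y t \<omega>) x * ennreal (exp (- q * x))"
  let ?v = "\<lambda>\<omega> x. ennreal (if 0 < x then exp (- q * x) else 0) * ennreal (exp (- l * below x (\<lambda>t. Y t \<omega>)))"
  let ?w = "\<lambda>x. ennreal (if 0 < x then exp (- q * x) else 0)"
  have um: "(\<lambda>(\<omega>, x). ?u m \<omega> x) \<in> borel_measurable (M \<Otimes>\<^sub>M lborel)" for m
  proof -
    have [measurable]: "Y (real n * (1 / real (Suc m))) \<in> borel_measurable M" for n
      by (intro meas) auto
    show ?thesis unfolding grid_sum_def by measurable
  qed
  have wint: "(\<integral>\<^sup>+x. ?w x \<partial>lborel) < \<infinity>"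
  proof -
    have "(\<integral>\<^sup>+x. ?w x \<partial>lborel) = (\<integral>\<^sup>+x. ennreal (if 0 < x then x powr (1 - 1) * exp (- q * x) else 0) \<partial>lborel)"
      by (intro nn_integral_cong) auto
    also have "\<dots> < \<infinity>" by (subst nn_integral_Gamma) (use q in auto)
    finally show ?thesis .
  qed
  have inner_lim: "AE \<omega> in M. (\<lambda>m. \<integral>\<^sup>+x. ?u m \<omega> x \<partial>lborel) \<longlonglongrightarrow> (\<integral>\<^sup>+x. ?v \<omega> x \<partial>lborel)"
    and inner_bd: "AE \<omega> in M. (\<integral>\<^sup>+x. ?u m \<omega> x \<partial>lborel) \<le> (\<integral>\<^sup>+x. ?w x \<partial>lborel)" for m
  proof -
    have bd: "?u m \<omega> x \<le> ?w x" if y: "subord_path (\<lambda>t. Y t \<omega>)" for m \<omega> x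
    proof (cases "0 < x")
      case True
      then show ?thesis
        using mult_right_mono[OF grid_sum_le_1[OF y _ l], of "1 / real (Suc m)" "ennreal (exp (- q * x))" x] by simp
    qed (use y in \<open>simp add: grid_sum_nonpos\<close>)
    show "AE \<omega> in M. (\<integral>\<^sup>+x. ?u m \<omega> x \<partial>lborel) \<le> (\<integral>\<^sup>+x. ?w x \<partial>lborel)"
      using good by eventually_elim (intro nn_integral_mono bd)
    show "AE \<omega> in M. (\<lambda>m. \<integral>\<^sup>+x. ?u m \<omega> x \<partial>lborel) \<longlonglongrightarrow> (\<integral>\<^sup>+x. ?v \<omega> x \<partial>lborel)"
      using good AE_space
    proof eventually_elim
      case (elim \<omega>)
      show ?case
      proof (rule nn_integral_dominated_convergence[OF _ _ _ _ wint])
        show "?u m \<omega> \<in> borel_measurable lborel" for m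
          using measurable_compose[OF measurable_Pair1'[OF elim(2)] um[of m]] by simp
        show "?v \<omega> \<in> borel_measurable lborel"
          using elim(2) by measurable
        show "AE x in lborel. ?u m \<omega> x \<le> ?w x" for m
          using bd[OF elim(1)] by simp
        have "(\<lambda>m. ?u m \<omega> x) \<longlonglongrightarrow> ?v \<omega> x" for x
        proof (cases "0 < x")
          case True
          have "(\<lambda>m. ?u m \<omega> x) \<longlonglongrightarrow> ennreal (exp (- l * below x (\<lambda>t. Y t \<omega>))) * ennreal (exp (- q * x))"
            by (intro tendsto_mult_ennreal grid_sum_tendsto elim True tendsto_const) auto
          then show ?thesis using True by (simp add: mult.commute)
        qed (use elim in \<open>simp add: grid_sum_nonpos\<close>)
        then show "AE x in lborel. (\<lambda>m. ?u m \<omega> x) \<longlonglongrightarrow> ?v \<omega> x" by simp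
      qed measurable
    qed
  qed
  have "(\<lambda>m. \<integral>\<^sup>+\<omega>. \<integral>\<^sup>+x. ?u m \<omega> x \<partial>lborel \<partial>M) \<longlonglongrightarrow> (\<integral>\<^sup>+\<omega>. \<integral>\<^sup>+x. ?v \<omega> x \<partial>lborel \<partial>M)"
  proof (rule nn_integral_dominated_convergence[OF _ _ _ inner_bd _ inner_lim])
    show "(\<lambda>\<omega>. \<integral>\<^sup>+x. ?u m \<omega> x \<partial>lborel) \<in> borel_measurable M" for m
      using um[of m] by measurable
    show "(\<integral>\<^sup>+\<omega>. \<integral>\<^sup>+x. ?w x \<partial>lborel \<partial>M) < \<infinity>" using wint by (simp add: emeasure_space_1)
  qed measurable
  moreover have "(\<lambda>m. \<integral>\<^sup>+\<omega>. \<integral>\<^sup>+x. ?u m \<omega> x \<partial>lborel \<partial>M) \<longlonglongrightarrow> ennreal (1 / q * (q powr \<beta> / (l + q) powr \<beta>))"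
  proof -
    have "(\<lambda>m. 1 / q * ((1 - exp (- (1 / real (Suc m)) * q powr \<beta>)) / (1 - exp (- (1 / real (Suc m)) * (l + q) powr \<beta>))))
      \<longlonglongrightarrow> 1 / q * (q powr \<beta> / (l + q) powr \<beta>)"
      using l q by (intro tendsto_mult tendsto_const one_minus_exp_quotient_tendsto) auto
    then have "(\<lambda>m. ennreal (1 / q * ((1 - exp (- (1 / real (Suc m)) * q powr \<beta>)) / (1 - exp (- (1 / real (Suc m)) * (l + q) powr \<beta>)))))
      \<longlonglongrightarrow> ennreal (1 / q * (q powr \<beta> / (l + q) powr \<beta>))"
      by (rule tendsto_ennrealI)
    moreover have "(\<integral>\<^sup>+\<omega>. \<integral>\<^sup>+x. ?u m \<omega> x \<partial>lborel \<partial>M) =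
      ennreal (1 / q * ((1 - exp (- (1 / real (Suc m)) * q powr \<beta>)) / (1 - exp (- (1 / real (Suc m)) * (l + q) powr \<beta>))))" for m
      by (subst nn_integral_grid_sum[OF Y l q]) auto
    ultimately show ?thesis by simp
  qed
  ultimately have "(\<integral>\<^sup>+\<omega>. \<integral>\<^sup>+x. ?v \<omega> x \<partial>lborel \<partial>M) = ennreal (1 / q * (q powr \<beta> / (l + q) powr \<beta>))"
    by (rule LIMSEQ_unique)
  also have "1 / q * (q powr \<beta> / (l + q) powr \<beta>) = q powr (\<beta> - 1) * (l + q) powr (- \<beta>)"
    using q by (simp add: powr_diff powr_minus field_simps)
  finally have "(\<integral>\<^sup>+\<omega>. \<integral>\<^sup>+x. ?v \<omega> x \<partial>lborel \<partial>M) = \<dots>" .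
  \<comment> \<open>The level integral moves outside: for fixed \<open>l\<close> the result is now a
    Laplace transform in the level, comparable with that of the beta law.\<close>
  moreover have "(\<integral>\<^sup>+\<omega>. \<integral>\<^sup>+x. ?v \<omega> x \<partial>lborel \<partial>M) = (\<integral>\<^sup>+x. \<integral>\<^sup>+\<omega>. ?v \<omega> x \<partial>M \<partial>lborel)"
    by (rule P.Fubini'[symmetric]) measurable
  moreover have "(\<integral>\<^sup>+\<omega>. ?v \<omega> x \<partial>M) = ?w x * (\<integral>\<^sup>+\<omega>. ennreal (exp (- l * below x (\<lambda>t. Y t \<omega>))) \<partial>M)" for x
  proof (rule nn_integral_cmult)
    have [measurable]: "(\<lambda>\<omega>. below x (\<lambda>t. Y t \<omega>)) \<in> borel_measurable M"
      by (intro measurable_below meas) auto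
    show "(\<lambda>\<omega>. ennreal (exp (- l * below x (\<lambda>t. Y t \<omega>)))) \<in> borel_measurable M" by measurable
  qed
  ultimately show ?thesis by simp
qed

text \<open>A value strictly below \<open>x\<close> is also strictly below all levels close to
  \<open>x\<close>. Only continuity from the left holds: if the path jumps to the value
  \<open>x\<close> exactly, the supremum jumps just above that level.\<close>

lemma below_tendsto_left:
  assumes y: "subord_path y" and x: "0 < x"
    and u: "\<And>n. 0 < u n" "\<And>n. u n < x" "u \<longlonglongrightarrow> x"
  shows "(\<lambda>n. below (u n) y) \<longlonglongrightarrow> below x y"
proof (rule order_tendstoI)
  fix c assume "c < below x y"
  then obtain q where q: "0 \<le> q" "y q < x" "c < y q" using below_approx[OF y x] by blast
  from u(3) q(2) have "\<forall>\<^sub>F n in sequentially. y q < u n" by (rule order_tendstoD(1))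
  then show "\<forall>\<^sub>F n in sequentially. c < below (u n) y"
    by eventually_elim (use q below_upper(2)[OF y q(1)] less_le_trans in blast)
next
  fix c assume c: "below x y < c"
  have "below (u n) y \<le> below x y" for n
  proof (rule ccontr)
    assume "\<not> below (u n) y \<le> below x y"
    then obtain q where q: "0 \<le> q" "y q < u n" "below x y < y q"
      using below_approx[OF y u(1), of "below x y" n] by auto
    with below_upper(2)[OF y q(1), of x] u(2)[of n] show False by simp
  qed
  with c show "\<forall>\<^sub>F n in sequentially. below (u n) y < c"
    by (intro always_eventually allI) (meson le_less_trans)
qed

text \<open>A full-measure set of levels meets every interval to the left of \<open>x\<close>, so
  approximating levels can be chosen in it.\<close>

lemma AE_lborel_dense_left:
  fixes x :: real
  assumes "AE u in lborel. Q u" and a: "a < x"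
  shows "\<exists>u. a < u \<and> u < x \<and> Q u"
proof (rule ccontr)
  assume *: "\<not> ?thesis"
  from assms(1) have "AE u in lborel. u \<notin> {a<..<x}"
    by eventually_elim (use * in auto)
  then have "emeasure lborel {a<..<x} = 0"
    by (subst (asm) AE_iff_measurable[of "{a<..<x}"]) auto
  with a show False by simp
qed

lemma AE_beta_law: "AE r in density lborel (\<lambda>r. ennreal (beta_dens \<beta> r)). 0 < r \<and> r < 1"
  by (subst AE_density) (auto simp: beta_dens_def)

theorem undershoot_law:
  assumes Y: "stable_subordinator M \<beta> Y" and \<beta>: "0 < \<beta>" "\<beta> < 1"
    and P: "prob_space (density lborel (\<lambda>r. ennreal (beta_dens \<beta> r)))" and x: "0 < x"
  shows "distr M borel (\<lambda>\<omega>. x - below x (\<lambda>t. Y t \<omega>)) =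
    distr (density lborel (\<lambda>r. ennreal (beta_dens \<beta> r))) borel (\<lambda>r. x * r)"
proof -
  let ?P = "density lborel (\<lambda>r. ennreal (beta_dens \<beta> r))"
  have lev: "levy_process M Y" using Y by (simp add: stable_subordinator_def)
  interpret M: prob_space M using lev by (simp add: levy_process_def)
  interpret P: prob_space ?P by (rule P)
  interpret MP: pair_sigma_finite M lborel ..
  have meas: "Y t \<in> borel_measurable M" if "0 \<le> t" for t
    using lev that by (simp add: levy_process_def)
  have good: "AE \<omega> in M. subord_path (\<lambda>t. Y t \<omega>)" by (rule stable_subordinator_AE_subord_path[OF Y])
  have [measurable]: "(\<lambda>(v, \<omega>). below v (\<lambda>t. Y t \<omega>)) \<in> borel_measurable (lborel \<Otimes>\<^sub>M M)"
    unfolding split_beta' by (intro measurable_below measurable_compose[OF measurable_snd meas]) auto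
  have bm[measurable]: "(\<lambda>\<omega>. below v (\<lambda>t. Y t \<omega>)) \<in> borel_measurable M" for v
    by (intro measurable_below meas) auto
  have bd[measurable]: "beta_dens \<beta> \<in> borel_measurable borel"
    unfolding beta_dens_def by measurable
  \<comment> \<open>\<open>F\<close> and \<open>G\<close> are the transforms at \<open>l\<close> of
    the two candidate laws at level \<open>v\<close>: the value before passage, and
    \<open>v * (1 - r)\<close> under the beta law.\<close>
  define F where "F l v = (\<integral>\<^sup>+\<omega>. ennreal (exp (- l * below v (\<lambda>t. Y t \<omega>))) \<partial>M)" for l v
  define G where "G l v = (\<integral>\<^sup>+r. ennreal (exp (- l * (v * (1 - r)))) \<partial>?P)" for l v
  have [measurable]: "F l \<in> borel_measurable lborel" for l unfolding F_def by measurable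
  have [measurable]: "G l \<in> borel_measurable lborel" for l unfolding G_def by measurable
  define f where "f l v = ennreal (if 0 < v then exp (- v) else 0) * F l v" for l v
  define g where "g l v = ennreal (if 0 < v then exp (- v) else 0) * G l v" for l v
  have [measurable]: "f l \<in> borel_measurable lborel" "g l \<in> borel_measurable lborel" for l
    unfolding f_def g_def by measurable
  \<comment> \<open>One factor \<open>exp (- v)\<close> is put into the density to make the measure
    on levels finite. The transform at \<open>n\<close> then uses the parameter
    \<open>n + 1\<close>, which is positive even for \<open>n = 0\<close>.\<close>
  have shift: "ennreal (if 0 < v then exp (- v) else 0) * A * ennreal (exp (- (real n * v))) =
      ennreal (if 0 < v then exp (- (real n + 1) * v) else 0) * A" for n v and A :: ennreal
  proof -
    have "exp (- (real n + 1) * v) = exp (- v) * exp (- (real n * v))"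
      by (simp add: exp_add[symmetric] algebra_simps)
    then show ?thesis by (auto simp: ennreal_mult mult_ac)
  qed
  have lapF: "(\<integral>\<^sup>+v. f l v * ennreal (exp (- (real n * v))) \<partial>lborel) =
      ennreal ((real n + 1) powr (\<beta> - 1) * (l + (real n + 1)) powr (- \<beta>))" if "0 \<le> l" for l n
    unfolding f_def shift F_def using that by (intro subordinator_below_laplace[OF Y]) auto
  have lapG: "(\<integral>\<^sup>+v. g l v * ennreal (exp (- (real n * v))) \<partial>lborel) =
      ennreal ((real n + 1) powr (\<beta> - 1) * (l + (real n + 1)) powr (- \<beta>))" if "0 \<le> l" for l n
    unfolding g_def shift G_def using that
    by (subst nn_integral_density, measurable) (intro beta_law_laplace \<beta>, auto)
  have AE_eq: "AE v in lborel. 0 < v \<longrightarrow> F l v = G l v" if l: "0 \<le> l" for l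
  proof -
    have "density lborel (f l) = density lborel (g l)"
    proof (rule laplace_unique)
      show "finite_measure (density lborel (f l))"
        using lapF[OF l, of 0] by (intro finite_measureI) (simp add: emeasure_density)
      show "finite_measure (density lborel (g l))"
        using lapG[OF l, of 0] by (intro finite_measureI) (simp add: emeasure_density)
      show "AE v in density lborel (f l). 0 \<le> v" "AE v in density lborel (g l). 0 \<le> v"
        by (auto simp: AE_density f_def g_def)
      show "(\<integral>\<^sup>+v. ennreal (exp (- (real n * v))) \<partial>density lborel (f l)) =
        (\<integral>\<^sup>+v. ennreal (exp (- (real n * v))) \<partial>density lborel (g l))" for n
        using lapF[OF l] lapG[OF l] by (simp add: nn_integral_density)
    qed auto
    \<comment> \<open>Equal measures have almost everywhere equal densities, and the positive weight
      cancels for \<open>v > 0\<close>.\<close>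
    then have "AE v in lborel. f l v = g l v"
      by (subst (asm) sigma_finite_measure.density_unique_iff[OF sigma_finite_lborel]) auto
    then show ?thesis
      by eventually_elim (auto simp: f_def g_def ennreal_mult_cancel_left)
  qed
  have eq: "F l x = G l x" if l: "0 \<le> l" for l
  proof -
    \<comment> \<open>Good levels increasing up to \<open>x\<close> within
      \<open>1 / (n + 1)\<close>; the maximum with \<open>0\<close> keeps them positive, where the
      equality holds.\<close>
    have "\<exists>u. max 0 (x - 1 / real (Suc n)) < u \<and> u < x \<and> (0 < u \<longrightarrow> F l u = G l u)" for n
      using x by (intro AE_lborel_dense_left AE_eq l) auto
    then obtain u where u: "\<And>n. max 0 (x - 1 / real (Suc n)) < u n" "\<And>n. u n < x"
        "\<And>n. 0 < u n \<longrightarrow> F l (u n) = G l (u n)"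
      by metis
    have u0: "0 < u n" "F l (u n) = G l (u n)" for n using u(1)[of n] u(3)[of n] by auto
    have "u \<longlonglongrightarrow> x"
    proof (rule tendsto_sandwich)
      show "(\<lambda>n. x - 1 / real (Suc n)) \<longlonglongrightarrow> x"
        using tendsto_diff[OF tendsto_const LIMSEQ_Suc[OF lim_1_over_n], of x] by simp
      show "\<forall>\<^sub>F n in sequentially. x - 1 / real (Suc n) \<le> u n"
        using u(1) by (intro always_eventually allI) (simp add: less_imp_le)
      show "\<forall>\<^sub>F n in sequentially. u n \<le> x" using u(2) by (intro always_eventually allI less_imp_le)
    qed auto
    note ux = this
    have "(\<lambda>n. F l (u n)) \<longlonglongrightarrow> F l x"
      unfolding F_def
    proof (rule nn_integral_dominated_convergence[where w = "\<lambda>_. 1"])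
      show "AE \<omega> in M. ennreal (exp (- l * below (u n) (\<lambda>t. Y t \<omega>))) \<le> 1" for n
        using good by eventually_elim
          (use below_bounds(1)[OF _ u0(1)] l in \<open>auto intro!: ennreal_le_1[THEN iffD2]\<close>)
      show "AE \<omega> in M. (\<lambda>n. ennreal (exp (- l * below (u n) (\<lambda>t. Y t \<omega>)))) \<longlonglongrightarrow>
          ennreal (exp (- l * below x (\<lambda>t. Y t \<omega>)))"
        using good by eventually_elim
          (intro tendsto_ennrealI tendsto_intros below_tendsto_left x u0(1) u(2) ux)
    qed (simp_all add: M.emeasure_space_1)
    moreover have "(\<lambda>n. G l (u n)) \<longlonglongrightarrow> G l x"
      unfolding G_def
    proof (rule nn_integral_dominated_convergence[where w = "\<lambda>_. 1"])
      show "AE r in ?P. ennreal (exp (- l * (u n * (1 - r)))) \<le> 1" for n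
        using AE_beta_law by eventually_elim
          (use u0(1)[of n] l in \<open>auto intro!: ennreal_le_1[THEN iffD2] mult_nonneg_nonneg\<close>)
      show "AE r in ?P. (\<lambda>n. ennreal (exp (- l * (u n * (1 - r))))) \<longlonglongrightarrow>
          ennreal (exp (- l * (x * (1 - r))))"
        by (intro AE_I2 tendsto_ennrealI tendsto_intros ux)
    qed (use P.emeasure_space_1 in simp_all)
    ultimately show ?thesis unfolding u0(2) by (rule LIMSEQ_unique)
  qed
  have "distr M borel (\<lambda>\<omega>. below x (\<lambda>t. Y t \<omega>)) = distr ?P borel (\<lambda>r. x * (1 - r))"
  proof (rule laplace_unique)
    show "finite_measure (distr M borel (\<lambda>\<omega>. below x (\<lambda>t. Y t \<omega>)))"
      by (intro M.finite_measure_distr) measurable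
    show "finite_measure (distr ?P borel (\<lambda>r. x * (1 - r)))"
      by (intro P.finite_measure_distr) measurable
    have "AE \<omega> in M. 0 \<le> below x (\<lambda>t. Y t \<omega>)"
      using good by eventually_elim (rule below_bounds(1)[OF _ x])
    then show "AE v in distr M borel (\<lambda>\<omega>. below x (\<lambda>t. Y t \<omega>)). 0 \<le> v"
      by (subst AE_distr_iff) auto
    have "AE r in ?P. 0 \<le> x * (1 - r)"
      using AE_beta_law by eventually_elim (use x in simp)
    then show "AE v in distr ?P borel (\<lambda>r. x * (1 - r)). 0 \<le> v"
      by (subst AE_distr_iff) auto
    show "(\<integral>\<^sup>+v. ennreal (exp (- (real n * v))) \<partial>distr M borel (\<lambda>\<omega>. below x (\<lambda>t. Y t \<omega>))) =
        (\<integral>\<^sup>+v. ennreal (exp (- (real n * v))) \<partial>distr ?P borel (\<lambda>r. x * (1 - r)))" for n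
      using eq[of "real n"] by (subst (1 2) nn_integral_distr) (auto simp: F_def G_def)
  qed auto
  then have "distr (distr M borel (\<lambda>\<omega>. below x (\<lambda>t. Y t \<omega>))) borel (\<lambda>v. x - v) =
      distr (distr ?P borel (\<lambda>r. x * (1 - r))) borel (\<lambda>v. x - v)"
    by simp
  then show ?thesis by (simp add: distr_distr comp_def algebra_simps)
qed

subsection \<open>The chain of residuals\<close>

text \<open>The position of the censored path at its \<open>j\<close>-th killing time, written
  without any reference to times. As a functional of the first \<open>j\<close> paths it is
  measurable, and it is independent of the next path.\<close>

primrec residual :: "real \<Rightarrow> (nat \<Rightarrow> real \<Rightarrow> real) \<Rightarrow> nat \<Rightarrow> real" where
  "residual x p 0 = x"
| "residual x p (Suc j) = residual x p j - below (residual x p j) (p (Suc j))"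

text \<open>Allows each path to be restricted to nonnegative times and the family to the indices
  \<open>1..j\<close>, so that the arguments are points of a product space.\<close>

lemma residual_cong:
  "(\<And>i t. 1 \<le> i \<Longrightarrow> i \<le> j \<Longrightarrow> 0 \<le> t \<Longrightarrow> p i t = p' i t) \<Longrightarrow> residual x p j = residual x p' j"
proof (induction j)
  case (Suc j)
  then have "residual x p j = residual x p' j" by simp
  moreover have "below v (p (Suc j)) = below v (p' (Suc j))" for v
    using Suc.prems by (intro below_cong) auto
  ultimately show ?case by simp
qed simp

lemma measurable_residual:
  "j \<le> n \<Longrightarrow> (\<lambda>p. residual x p j) \<in> borel_measurable (Pi\<^sub>M {1..n} (\<lambda>_. path_space))"
proof (induction j)
  case (Suc j)
  then have r: "(\<lambda>p. residual x p j) \<in> borel_measurable (Pi\<^sub>M {1..n} (\<lambda>_. path_space))" by simp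
  have "(\<lambda>p. below (residual x p j) (p (Suc j))) \<in> borel_measurable (Pi\<^sub>M {1..n} (\<lambda>_. path_space))"
  proof (rule measurable_below)
    fix q :: real assume q: "0 \<le> q"
    have "(\<lambda>p. p (Suc j)) \<in> measurable (Pi\<^sub>M {1..n} (\<lambda>_. path_space)) path_space"
      using Suc.prems by (intro measurable_component_singleton) auto
    then show "(\<lambda>p. p (Suc j) q) \<in> borel_measurable (Pi\<^sub>M {1..n} (\<lambda>_. path_space))"
      by (rule measurable_compose) (use q in \<open>auto intro!: measurable_component_singleton\<close>)
  qed (rule r)
  with r show ?case by (simp only: residual.simps) (rule borel_measurable_diff)
qed simp

text \<open>Fubini: by independence, the law of \<open>H (V \<omega>) (Q \<omega>)\<close> is the
  mixture, over the law of \<open>V\<close>, of the laws with the first argument frozen.\<close>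

lemma (in prob_space) emeasure_distr_indep:
  assumes rv: "V \<in> borel_measurable M" "Q \<in> measurable M E"
    and joint: "distr M borel V \<Otimes>\<^sub>M distr M E Q = distr M (borel \<Otimes>\<^sub>M E) (\<lambda>\<omega>. (V \<omega>, Q \<omega>))"
    and H: "(\<lambda>(v, q). H v q) \<in> borel_measurable (borel \<Otimes>\<^sub>M E)" and A: "A \<in> sets borel"
  shows "emeasure (distr M borel (\<lambda>\<omega>. H (V \<omega>) (Q \<omega>) :: real)) A =
    (\<integral>\<^sup>+v. emeasure (distr (distr M E Q) borel (H v)) A \<partial>distr M borel V)"
proof -
  note [measurable] = A H rv
  interpret V: prob_space "distr M borel V" by (rule prob_space_distr) simp
  interpret Q: prob_space "distr M E Q" by (rule prob_space_distr) simp
  have sec: "H v \<in> borel_measurable E" for v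
    using measurable_compose[OF measurable_Pair1'[of v borel E] H] by simp
  have "emeasure (distr M borel (\<lambda>\<omega>. H (V \<omega>) (Q \<omega>))) A = (\<integral>\<^sup>+\<omega>. indicator A (H (V \<omega>) (Q \<omega>)) \<partial>M)"
    by (subst nn_integral_indicator[symmetric], simp, subst nn_integral_distr) auto
  also have "\<dots> = (\<integral>\<^sup>+z. indicator A (case z of (v, q) \<Rightarrow> H v q) \<partial>(distr M borel V \<Otimes>\<^sub>M distr M E Q))"
    unfolding joint by (subst nn_integral_distr) auto
  also have "\<dots> = (\<integral>\<^sup>+v. \<integral>\<^sup>+q. indicator A (H v q) \<partial>distr M E Q \<partial>distr M borel V)"
    by (subst Q.nn_integral_fst[symmetric]) auto
  also have "\<dots> = (\<integral>\<^sup>+v. emeasure (distr (distr M E Q) borel (H v)) A \<partial>distr M borel V)"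
  proof (rule nn_integral_cong)
    fix v
    have [measurable]: "H v \<in> borel_measurable E" by (rule sec)
    show "(\<integral>\<^sup>+q. indicator A (H v q) \<partial>distr M E Q) = emeasure (distr (distr M E Q) borel (H v)) A"
      by (subst nn_integral_indicator[symmetric], simp, subst (2) nn_integral_distr) auto
  qed
  finally show ?thesis .
qed

text \<open>The induction step for comparing two Markov chains. Their driving noises may live in
  different spaces, here a whole path on one side and a single number on the other; only the
  one-step kernels must agree, and only for almost every state.\<close>

lemma distr_indep_eqI:
  assumes MN: "prob_space M" "prob_space N"
    and rv: "V \<in> borel_measurable M" "Q \<in> measurable M E" "X \<in> borel_measurable N" "R \<in> measurable N F"
    and joint: "distr M borel V \<Otimes>\<^sub>M distr M E Q = distr M (borel \<Otimes>\<^sub>M E) (\<lambda>\<omega>. (V \<omega>, Q \<omega>))"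
      "distr N borel X \<Otimes>\<^sub>M distr N F R = distr N (borel \<Otimes>\<^sub>M F) (\<lambda>\<omega>. (X \<omega>, R \<omega>))"
    and meas: "(\<lambda>(v, q). H v q) \<in> borel_measurable (borel \<Otimes>\<^sub>M E)"
      "(\<lambda>(v, q). G v q) \<in> borel_measurable (borel \<Otimes>\<^sub>M F)"
    and law: "distr M borel V = distr N borel X"
    and kernel: "AE v in distr M borel V. distr (distr M E Q) borel (H v) = distr (distr N F R) borel (G v)"
  shows "distr M borel (\<lambda>\<omega>. H (V \<omega>) (Q \<omega>) :: real) = distr N borel (\<lambda>\<omega>. G (X \<omega>) (R \<omega>))"
proof (rule measure_eqI)
  fix A assume "A \<in> sets (distr M borel (\<lambda>\<omega>. H (V \<omega>) (Q \<omega>)))"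
  then have A: "A \<in> sets borel" by simp
  have "AE v in distr M borel V. emeasure (distr (distr M E Q) borel (H v)) A =
      emeasure (distr (distr N F R) borel (G v)) A"
    using kernel by eventually_elim simp
  then show "emeasure (distr M borel (\<lambda>\<omega>. H (V \<omega>) (Q \<omega>))) A = emeasure (distr N borel (\<lambda>\<omega>. G (X \<omega>) (R \<omega>))) A"
    unfolding prob_space.emeasure_distr_indep[OF MN(1) rv(1,2) joint(1) meas(1) A]
      prob_space.emeasure_distr_indep[OF MN(2) rv(3,4) joint(2) meas(2) A] law[symmetric]
    by (rule nn_integral_cong_AE)
qed simp

text \<open>Disjoint blocks of an independent family are independent. The block
  \<open>{Suc j}\<close> gives a product over a singleton, which is then projected to its one
  component.\<close>

lemma (in prob_space) indep_vars_prefix_next: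
  assumes ind: "indep_vars (\<lambda>_. E) X {1..}" and f: "f \<in> measurable (Pi\<^sub>M {1..j} (\<lambda>_. E)) L"
  shows "(\<lambda>\<omega>. f (\<lambda>i\<in>{1..j}. X i \<omega>)) \<in> measurable M L" "X (Suc j) \<in> measurable M E"
    "distr M L (\<lambda>\<omega>. f (\<lambda>i\<in>{1..j}. X i \<omega>)) \<Otimes>\<^sub>M distr M E (X (Suc j)) =
      distr M (L \<Otimes>\<^sub>M E) (\<lambda>\<omega>. (f (\<lambda>i\<in>{1..j}. X i \<omega>), X (Suc j) \<omega>))"
proof -
  let ?P = "Pi\<^sub>M {1..j} (\<lambda>_. E)" and ?Q = "Pi\<^sub>M {Suc j} (\<lambda>_. E)"
  let ?V = "\<lambda>\<omega>. \<lambda>i\<in>{1..j}. X i \<omega>" and ?W = "\<lambda>\<omega>. \<lambda>i\<in>{Suc j}. X i \<omega>"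
  have "indep_var ?P ?V ?Q ?W" by (rule indep_var_restrict[OF ind]) auto
  then have V[measurable]: "?V \<in> measurable M ?P" and W[measurable]: "?W \<in> measurable M ?Q"
    and joint: "distr M ?P ?V \<Otimes>\<^sub>M distr M ?Q ?W = distr M (?P \<Otimes>\<^sub>M ?Q) (\<lambda>\<omega>. (?V \<omega>, ?W \<omega>))"
    by (auto simp: indep_var_distribution_eq)
  note [measurable] = f
  have g[measurable]: "(\<lambda>p. p (Suc j)) \<in> measurable ?Q E" by (intro measurable_component_singleton) simp
  show "(\<lambda>\<omega>. f (?V \<omega>)) \<in> measurable M L" by measurable
  show X: "X (Suc j) \<in> measurable M E" using measurable_compose[OF W g] by simp
  interpret Q: prob_space "distr (distr M ?Q ?W) E (\<lambda>p. p (Suc j))"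
    by (intro prob_space.prob_space_distr prob_space_distr) auto
  have "distr M L (\<lambda>\<omega>. f (?V \<omega>)) \<Otimes>\<^sub>M distr M E (X (Suc j)) =
      distr (distr M ?P ?V) L f \<Otimes>\<^sub>M distr (distr M ?Q ?W) E (\<lambda>p. p (Suc j))"
    using distr_distr[OF f V] distr_distr[OF g W] by (simp add: comp_def)
  also have "\<dots> = distr (distr M ?P ?V \<Otimes>\<^sub>M distr M ?Q ?W) (L \<Otimes>\<^sub>M E) (\<lambda>(p, q). (f p, q (Suc j)))"
    by (rule pair_measure_distr) (unfold measurable_distr_eq1, rule f, rule g, rule Q.sigma_finite_measure_axioms)
  also have "\<dots> = distr M (L \<Otimes>\<^sub>M E) (\<lambda>\<omega>. (f (?V \<omega>), X (Suc j) \<omega>))"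
    unfolding joint
  proof (subst distr_distr)
    show "(\<lambda>(p, q). (f p, q (Suc j))) \<in> measurable (?P \<Otimes>\<^sub>M ?Q) (L \<Otimes>\<^sub>M E)" by measurable
    show "(\<lambda>\<omega>. (?V \<omega>, ?W \<omega>)) \<in> measurable M (?P \<Otimes>\<^sub>M ?Q)" by measurable
  qed (simp add: comp_def)
  finally show "distr M L (\<lambda>\<omega>. f (?V \<omega>)) \<Otimes>\<^sub>M distr M E (X (Suc j)) = \<dots>" .
qed

section \<open>The multiplicative beta chain\<close>

lemma beta_chain_eq_prod: "beta_chain B x j \<omega> = x * (\<Prod>i\<in>{1..j}. (\<lambda>i\<in>{1..j}. B i \<omega>) i)"
  unfolding beta_chain_def by (intro arg_cong2[where f = "(*)"] prod.cong) auto

locale beta_sequence =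
  fixes N :: "'b measure" and \<beta> :: real and B :: "nat \<Rightarrow> 'b \<Rightarrow> real"
  assumes prob_N: "prob_space N"
    and B_dist: "\<And>i. 1 \<le> i \<Longrightarrow> distributed N lborel (B i) (\<lambda>r. ennreal (beta_dens \<beta> r))"
    and B_iid: "iid_vars N borel B {1..}"
begin

sublocale prob_space N by (rule prob_N)

abbreviation beta_law :: "real measure" where
  "beta_law \<equiv> density lborel (\<lambda>r. ennreal (beta_dens \<beta> r))"

lemma measurable_B: "1 \<le> i \<Longrightarrow> B i \<in> borel_measurable N"
  using distributed_measurable[OF B_dist] by simp

lemma distr_B: "1 \<le> i \<Longrightarrow> distr N borel (B i) = beta_law"
  using distributed_distr_eq_density[OF B_dist, of i] distr_cong[of N N borel lborel "B i" "B i"] by simp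

text \<open>The normalisation is inherited from the given variable \<open>B 1\<close>; no Beta
  integral is evaluated.\<close>

lemma prob_space_beta_law: "prob_space beta_law"
  using prob_space_distr[OF measurable_B[of 1]] distr_B[of 1] by simp

lemma AE_B:
  assumes i: "1 \<le> i"
  shows "AE \<omega> in N. 0 < B i \<omega> \<and> B i \<omega> < 1"
proof -
  have "AE r in distr N borel (B i). 0 < r \<and> r < 1" unfolding distr_B[OF i] by (rule AE_beta_law)
  then show ?thesis by (subst (asm) AE_distr_iff) (auto intro: measurable_B[OF i])
qed

lemma measurable_beta_chain[measurable]: "beta_chain B x j \<in> borel_measurable N"
  unfolding beta_chain_def[abs_def] by (intro borel_measurable_times borel_measurable_prod measurable_B) auto

lemma AE_beta_chain: "AE \<omega> in N. \<forall>i\<ge>1. 0 < B i \<omega> \<and> B i \<omega> < 1"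
  by (subst AE_all_countable) (use AE_B in auto)

lemma AE_beta_chain_pos: "0 < x \<Longrightarrow> AE \<omega> in N. 0 < beta_chain B x j \<omega>"
  using AE_beta_chain by eventually_elim (auto simp: beta_chain_def intro!: mult_pos_pos prod_pos)

lemma beta_chain_Suc: "beta_chain B x (Suc j) \<omega> = beta_chain B x j \<omega> * B (Suc j) \<omega>"
  by (simp add: beta_chain_def)

lemma joint_beta_chain:
  "distr N borel (beta_chain B x j) \<Otimes>\<^sub>M distr N borel (B (Suc j)) =
    distr N (borel \<Otimes>\<^sub>M borel) (\<lambda>\<omega>. (beta_chain B x j \<omega>, B (Suc j) \<omega>))"
proof -
  have ind: "indep_vars (\<lambda>_. borel) B {1..}" using B_iid by (simp add: iid_vars_def)
  have "(\<lambda>p. x * (\<Prod>i\<in>{1..j}. p i)) \<in> borel_measurable (Pi\<^sub>M {1..j} (\<lambda>_. borel))"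
    by (intro borel_measurable_times borel_measurable_prod measurable_component_singleton) auto
  from indep_vars_prefix_next(3)[OF ind this] show ?thesis
    unfolding beta_chain_eq_prod[symmetric] .
qed

end

lemma measurable_below_pair: "(\<lambda>(v, p). v - below v p) \<in> borel_measurable (borel \<Otimes>\<^sub>M path_space)"
proof -
  have "(\<lambda>z. below (fst z) (snd z)) \<in> borel_measurable (borel \<Otimes>\<^sub>M path_space)"
  proof (rule measurable_below)
    show "(\<lambda>z. snd z q) \<in> borel_measurable (borel \<Otimes>\<^sub>M path_space)" if "0 \<le> q" for q
      by (rule measurable_compose[OF measurable_snd]) (use that in \<open>auto intro: measurable_component_singleton\<close>)
  qed simp
  then show ?thesis by (simp add: split_beta')
qed

subsection \<open>The censored path at its killing times\<close>

text \<open>Changing a measurable map on a null set leaves it measurable for the completion and does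
  not change its law.\<close>

lemma measurable_completion_AE:
  assumes g: "g \<in> measurable M E" and eq: "AE \<omega> in M. f \<omega> = g \<omega>" and f: "f \<in> space M \<rightarrow> space E"
  shows "f \<in> measurable (completion M) E" "distr (completion M) E f = distr M E g"
proof -
  obtain Z where Z: "Z \<in> null_sets M" "{\<omega> \<in> space M. f \<omega> \<noteq> g \<omega>} \<subseteq> Z"
    using eq by (auto simp: eventually_ae_filter)
  have vim: "f -` A \<inter> space M \<in> sets (completion M) \<and> emeasure (completion M) (f -` A \<inter> space M) = emeasure M (g -` A \<inter> space M)"
    if A: "A \<in> sets E" for A
  proof -
    let ?F = "f -` A \<inter> space M" and ?G = "g -` A \<inter> space M"
    have G: "?G \<in> sets M" by (rule measurable_sets[OF g A])
    have N: "?F \<inter> Z \<in> null_sets (completion M)"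
      by (rule null_sets_completion_subset[OF _ null_sets_completionI[OF Z(1)]]) auto
    have G': "?G - Z \<in> sets M" using G Z(1) by auto
    \<comment> \<open>Off \<open>Z\<close> the two preimages coincide; inside \<open>Z\<close> any
      set is null for the completion.\<close>
    have "?F = (?G - Z) \<union> (?F \<inter> Z)" using Z(2) by auto
    moreover have "(?G - Z) \<union> (?F \<inter> Z) \<in> sets (completion M)"
      by (intro sets.Un sets_completionI_sets G' null_setsD2[OF N])
    moreover have "emeasure (completion M) ((?G - Z) \<union> (?F \<inter> Z)) = emeasure (completion M) (?G - Z)"
      by (rule emeasure_Un_null_set[OF sets_completionI_sets[OF G'] N])
    moreover have "emeasure (completion M) (?G - Z) = emeasure M ?G"
      using G G' Z(1) by (simp add: emeasure_Diff_null_set)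
    ultimately show ?thesis by simp
  qed
  show fm: "f \<in> measurable (completion M) E"
  proof (rule measurableI)
    show "f \<omega> \<in> space E" if "\<omega> \<in> space (completion M)" for \<omega> using f that by auto
    show "f -` A \<inter> space (completion M) \<in> sets (completion M)" if "A \<in> sets E" for A using vim[OF that] by simp
  qed
  show "distr (completion M) E f = distr M E g"
  proof (rule measure_eqI)
    show "emeasure (distr (completion M) E f) A = emeasure (distr M E g) A"
      if "A \<in> sets (distr (completion M) E f)" for A
      using vim[of A] that by (simp add: emeasure_distr[OF fm] emeasure_distr[OF g])
  qed simp
qed

text \<open>The piece that starts at height \<open>r\<close> at time \<open>T\<close> is killed when
  \<open>- s (Suc j)\<close> first reaches \<open>r\<close>. The waiting time is the
  \<open>\<sigma>\<close> of \<open>first_passage\<close>, and the left limit there gives the height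
  at which the next piece starts.\<close>

lemma cens_step:
  assumes s: "subord_path (\<lambda>t. - s (Suc j) t)" and r: "0 < r"
    and T: "cens_time s x j = ereal T"
    and tilde: "\<And>t. cens_tilde s x (Suc j) t = r + s (Suc j) (t - T)"
  shows "\<exists>T'>T. cens_time s x (Suc j) = ereal T' \<and>
    (\<forall>t. cens_tilde s x (Suc (Suc j)) t = r - below r (\<lambda>t. - s (Suc j) t) + s (Suc (Suc j)) (t - T'))"
proof -
  obtain \<sigma> where \<sigma>: "0 < \<sigma>" "\<And>t. 0 \<le> t \<Longrightarrow> r \<le> - s (Suc j) t \<longleftrightarrow> \<sigma> \<le> t"
      "((\<lambda>t. - s (Suc j) t) \<longlongrightarrow> below r (\<lambda>t. - s (Suc j) t)) (at_left \<sigma>)"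
    using first_passage[OF s r] by blast
  \<comment> \<open>Since \<open>\<sigma> > 0\<close>, the constraint \<open>T < t\<close> is
    implied by \<open>T + \<sigma> \<le> t\<close>; conversely it keeps the argument of the path
    positive.\<close>
  have "T < t \<and> r + s (Suc j) (t - T) \<le> 0 \<longleftrightarrow> T + \<sigma> \<le> t" for t
    using \<sigma>(1) \<sigma>(2)[of "t - T"] by auto
  then have "{ereal t |t. cens_time s x j < ereal t \<and> cens_tilde s x (Suc j) t \<le> 0} = ereal ` {T + \<sigma>..}"
    unfolding T tilde by auto
  then have time: "cens_time s x (Suc j) = ereal (T + \<sigma>)"
    by (auto intro!: Inf_eqI)
  have "filterlim (\<lambda>u. u - T) (at_left \<sigma>) (at_left (T + \<sigma>))"
    unfolding filterlim_at
    by (auto intro!: tendsto_eq_intros simp: eventually_at_filter)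
  from filterlim_compose[OF \<sigma>(3) this]
  have "((\<lambda>u. - s (Suc j) (u - T)) \<longlongrightarrow> below r (\<lambda>t. - s (Suc j) t)) (at_left (T + \<sigma>))" by simp
  from tendsto_diff[OF tendsto_const[of r] this]
  have "((\<lambda>u. cens_tilde s x (Suc j) u) \<longlongrightarrow> r - below r (\<lambda>t. - s (Suc j) t)) (at_left (T + \<sigma>))"
    unfolding tilde by simp
  then have "Lim (at_left (T + \<sigma>)) (\<lambda>u. cens_tilde s x (Suc j) u) = r - below r (\<lambda>t. - s (Suc j) t)"
    by (intro tendsto_Lim) auto
  with \<sigma>(1) time show ?thesis by (intro exI[of _ "T + \<sigma>"]) (simp del: cens_time.simps(2))
qed

text \<open>As long as residuals stay positive, \<open>cens_step\<close> iterates and yields finite,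
  strictly increasing killing times. Hence every killing time lies before the lifetime and exactly
  one piece is running at it.\<close>

lemma censored_at_cens_time:
  assumes s: "\<And>i. 1 \<le> i \<Longrightarrow> subord_path (\<lambda>t. - s i t)"
    and r: "\<And>j. 0 < residual x (\<lambda>i t. - s i t) j"
  shows "censored s x (cens_time s x j) = Some (residual x (\<lambda>i t. - s i t) j)"
proof -
  let ?r = "residual x (\<lambda>i t. - s i t)"
  define P where "P j T \<longleftrightarrow> cens_time s x j = ereal T \<and>
    (\<forall>t. cens_tilde s x (Suc j) t = ?r j + s (Suc j) (t - T))" for j T
  have step: "\<exists>T'>T. P (Suc j) T'" if "P j T" for j T
    using cens_step[of s j "?r j" x T, OF s r] that unfolding P_def by simp
  have "P 0 0" by (simp add: P_def)
  then have "\<exists>T. \<forall>n. P n (T n) \<and> T n < T (Suc n)"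
    using step by (intro dependent_nat_choice) blast+
  then obtain T where T: "\<And>j. P j (T j)" "\<And>j. T j < T (Suc j)" by blast
  have sm: "strict_mono T" using T(2) by (simp add: strict_mono_Suc_iff)
  have time: "cens_time s x i = ereal (T i)" and
    tilde: "cens_tilde s x (Suc i) t = ?r i + s (Suc i) (t - T i)" for i t
    using T(1)[of i] by (auto simp: P_def)
  have "incseq (cens_time s x)" unfolding time[abs_def]
    using strict_mono_mono[OF sm] by (auto simp: mono_def)
  then have life: "cens_lifetime s x = (SUP i. cens_time s x i)"
    unfolding cens_lifetime_def by (intro limI LIMSEQ_SUP)
  have "cens_time s x j < cens_time s x (Suc j)" unfolding time using T(2) by simp
  also have "\<dots> \<le> cens_lifetime s x" unfolding life by (rule SUP_upper) simp
  finally have alive: "cens_time s x j < cens_lifetime s x" .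
  \<comment> \<open>Pieces live on intervals closed on the left, so at the \<open>j\<close>-th
    killing time piece \<open>Suc j\<close> is already running. Its driving path is then at time
    \<open>0\<close>, which leaves just the residual.\<close>
  have "(THE i. 1 \<le> i \<and> cens_time s x (i - 1) \<le> cens_time s x j \<and> cens_time s x j < cens_time s x i) = Suc j"
  proof (rule the_equality)
    show "1 \<le> Suc j \<and> cens_time s x (Suc j - 1) \<le> cens_time s x j \<and> cens_time s x j < cens_time s x (Suc j)"
      unfolding time using T(2) by simp
    show "i = Suc j" if "1 \<le> i \<and> cens_time s x (i - 1) \<le> cens_time s x j \<and> cens_time s x j < cens_time s x i" for i
      using that unfolding time
      by (auto simp: strict_mono_less_eq[OF sm] strict_mono_less[OF sm])
  qed
  moreover have "s (Suc j) 0 = 0" using s[of "Suc j"] by (simp add: subord_path_def)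
  ultimately show ?thesis using alive unfolding censored_def by (simp add: time tilde)
qed

section \<open>Laws of the residuals and of the censored path\<close>

locale censored_setting = beta_sequence N \<beta> B
  for N :: "'b measure" and \<beta> :: real and B :: "nat \<Rightarrow> 'b \<Rightarrow> real" +
  fixes M :: "'a measure" and S :: "nat \<Rightarrow> real \<Rightarrow> 'a \<Rightarrow> real"
  assumes \<beta>: "0 < \<beta>" "\<beta> < 1"
    and prob_M: "prob_space M"
    and S_stable: "\<And>j. 1 \<le> j \<Longrightarrow> stable_subordinator M \<beta> (\<lambda>t \<omega>. - S j t \<omega>)"
    and S_iid: "iid_vars M path_space (\<lambda>j. path_of (\<lambda>t \<omega>. - S j t \<omega>)) {1..}"
begin

interpretation M: prob_space M by (rule prob_M)

abbreviation Res :: "real \<Rightarrow> nat \<Rightarrow> 'a \<Rightarrow> real" where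
  "Res x j \<omega> \<equiv> residual x (\<lambda>i t. - S i t \<omega>) j"

lemma Res_next:
  shows measurable_Res[measurable]: "Res x j \<in> borel_measurable M"
    and measurable_path_of: "path_of (\<lambda>t \<omega>. - S (Suc j) t \<omega>) \<in> measurable M path_space"
    and joint_Res: "distr M borel (Res x j) \<Otimes>\<^sub>M distr M path_space (path_of (\<lambda>t \<omega>. - S (Suc j) t \<omega>)) =
      distr M (borel \<Otimes>\<^sub>M path_space) (\<lambda>\<omega>. (Res x j \<omega>, path_of (\<lambda>t \<omega>. - S (Suc j) t \<omega>) \<omega>))"
proof -
  have ind: "M.indep_vars (\<lambda>_. path_space) (\<lambda>j. path_of (\<lambda>t \<omega>. - S j t \<omega>)) {1..}"
    using S_iid by (simp add: iid_vars_def)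
  have eq: "residual x (\<lambda>i\<in>{1..j}. path_of (\<lambda>t \<omega>. - S i t \<omega>) \<omega>) j = Res x j \<omega>" for x j \<omega>
    by (rule residual_cong) (auto simp: path_of_def)
  note M.indep_vars_prefix_next[OF ind measurable_residual[OF order_refl], unfolded eq]
  then
  show "Res x j \<in> borel_measurable M" "path_of (\<lambda>t \<omega>. - S (Suc j) t \<omega>) \<in> measurable M path_space"
    "distr M borel (Res x j) \<Otimes>\<^sub>M distr M path_space (path_of (\<lambda>t \<omega>. - S (Suc j) t \<omega>)) =
      distr M (borel \<Otimes>\<^sub>M path_space) (\<lambda>\<omega>. (Res x j \<omega>, path_of (\<lambda>t \<omega>. - S (Suc j) t \<omega>) \<omega>))"
    by this+
qed

text \<open>For each \<open>v > 0\<close> the one-step kernels agree by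
  \<open>undershoot_law\<close>. That the current residual is almost surely positive comes from the
  beta chain through the induction hypothesis.\<close>

lemma distr_Res:
  assumes x: "0 < x"
  shows "distr M borel (Res x j) = distr N borel (beta_chain B x j)"
proof (induction j)
  case 0
  have "distr M borel (\<lambda>_. x) = distr N borel (\<lambda>_. x)"
    by (rule measure_eqI) (auto simp: emeasure_distr M.emeasure_space_1 emeasure_space_1 vimage_const split: if_splits)
  then show ?case by (simp add: beta_chain_def[abs_def])
next
  case (Suc j)
  have "distr M borel (\<lambda>\<omega>. Res x j \<omega> - below (Res x j \<omega>) (path_of (\<lambda>t \<omega>. - S (Suc j) t \<omega>) \<omega>)) =
      distr N borel (\<lambda>\<omega>. beta_chain B x j \<omega> * B (Suc j) \<omega>)"
  proof (rule distr_indep_eqI[OF prob_M prob_N measurable_Res measurable_path_of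
      measurable_beta_chain measurable_B joint_Res joint_beta_chain measurable_below_pair _ Suc.IH])
    have "AE v in distr N borel (beta_chain B x j). 0 < v"
      using AE_beta_chain_pos[OF x] by (subst AE_distr_iff) auto
    then show "AE v in distr M borel (Res x j).
        distr (distr M path_space (path_of (\<lambda>t \<omega>. - S (Suc j) t \<omega>))) borel (\<lambda>p. v - below v p) =
        distr (distr N borel (B (Suc j))) borel (\<lambda>b. v * b)"
      unfolding Suc.IH
    proof eventually_elim
      case (elim v)
      have [measurable]: "path_of (\<lambda>t \<omega>. - S (Suc j) t \<omega>) \<in> measurable M path_space"
        by (rule measurable_path_of)
      have [measurable]: "(\<lambda>p. v - below v p) \<in> borel_measurable path_space"
        using measurable_compose[OF measurable_Pair1'[of v borel path_space] measurable_below_pair] by simp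
      have "distr (distr M path_space (path_of (\<lambda>t \<omega>. - S (Suc j) t \<omega>))) borel (\<lambda>p. v - below v p) =
          distr M borel (\<lambda>\<omega>. v - below v (path_of (\<lambda>t \<omega>. - S (Suc j) t \<omega>) \<omega>))"
        by (simp add: distr_distr comp_def)
      also have "\<dots> = distr M borel (\<lambda>\<omega>. v - below v (\<lambda>t. - S (Suc j) t \<omega>))"
        by (intro arg_cong[where f = "distr M borel"] ext arg_cong2[where f = "(-)"] refl below_cong)
          (simp add: path_of_def)
      also have "\<dots> = distr beta_law borel (\<lambda>b. v * b)"
        by (rule undershoot_law[OF S_stable \<beta> prob_space_beta_law elim]) simp
      finally show ?case by (simp add: distr_B)
    qed
  qed auto
  moreover have "below v (path_of (\<lambda>t \<omega>. - S (Suc j) t \<omega>) \<omega>) = below v (\<lambda>t. - S (Suc j) t \<omega>)" for v \<omega>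
    by (rule below_cong) (simp add: path_of_def)
  ultimately show ?case by (simp add: beta_chain_Suc[abs_def])
qed

text \<open>Not a pathwise fact: the path \<open>y t = t\<close> satisfies
  \<open>subord_path\<close> but leaves residual zero. Positivity is transferred from the beta chain
  by equality of laws.\<close>

lemma AE_Res_pos:
  assumes x: "0 < x"
  shows "AE \<omega> in M. \<forall>j. 0 < Res x j \<omega>"
proof (subst AE_all_countable, rule)
  fix j
  have "AE v in distr M borel (Res x j). 0 < v"
    unfolding distr_Res[OF x] using AE_beta_chain_pos[OF x] by (subst AE_distr_iff) auto
  then show "AE \<omega> in M. 0 < Res x j \<omega>" by (subst (asm) AE_distr_iff) auto
qed

end

context censored_setting
begin

theorem eq_in_law_censored:
  assumes x: "0 < x"
  shows "eq_in_law borel_cemetery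
    M (\<lambda>\<omega>. censored (\<lambda>i t. S i t \<omega>) x (cens_time (\<lambda>i t. S i t \<omega>) x j))
    N (\<lambda>\<omega>. Some (beta_chain B x j \<omega>))"
proof -
  \<comment> \<open>\<open>Some\<close> is injective, so pulling back a generator gives the original
    Borel set.\<close>
  have [measurable]: "Some \<in> measurable borel borel_cemetery"
    unfolding borel_cemetery_def
    by (rule measurable_measure_of) (auto intro: sets.sets_into_space simp: vimage_image_eq inj_vimage_image_eq)
  have "AE \<omega> in M. \<forall>i. 1 \<le> i \<longrightarrow> subord_path (\<lambda>t. - S i t \<omega>)"
    using stable_subordinator_AE_subord_path[OF S_stable] by (subst AE_all_countable) auto
  with AE_Res_pos[OF x]
  have AE: "AE \<omega> in M. censored (\<lambda>i t. S i t \<omega>) x (cens_time (\<lambda>i t. S i t \<omega>) x j) = Some (Res x j \<omega>)"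
    by eventually_elim (rule censored_at_cens_time, auto)
  have sp: "space borel_cemetery = UNIV" by (simp add: borel_cemetery_def space_measure_of_conv)
  note C = measurable_completion_AE[OF _ AE, of borel_cemetery, unfolded sp]
  have "distr M borel_cemetery (\<lambda>\<omega>. Some (Res x j \<omega>)) = distr (distr M borel (Res x j)) borel_cemetery Some"
    by (simp add: distr_distr comp_def)
  also have "\<dots> = distr N borel_cemetery (\<lambda>\<omega>. Some (beta_chain B x j \<omega>))"
    unfolding distr_Res[OF x] by (simp add: distr_distr comp_def)
  also have "\<dots> = distr (completion N) borel_cemetery (\<lambda>\<omega>. Some (beta_chain B x j \<omega>))"
    by (rule distr_completion[symmetric]) measurable
  finally show ?thesis
    unfolding eq_in_law_def using C by (auto intro!: measurable_completion)
qed

end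

subsection \<open>The operators and the beta chain\<close>

text \<open>The kernel is homogeneous of degree \<open>-1\<close>; the substitution
  \<open>r = x * u\<close> absorbs all powers of \<open>x\<close> and leaves the beta
  density.\<close>

lemma K_op_eq_beta_integral:
  assumes x: "0 < x" "x \<le> T"
  shows "K_op T \<beta> \<psi> x = (\<integral>u. beta_dens \<beta> u * \<psi> (x * u) \<partial>lborel)"
proof -
  have "K_op T \<beta> \<psi> x = (\<integral>r. indicator {0<..<x} r *
      ((x - r) powr (\<beta> - 1) * r powr (- \<beta>) / (Gamma \<beta> * Gamma (1 - \<beta>)) * \<psi> r) \<partial>lborel)"
    using x by (simp add: K_op_def set_lebesgue_integral_def)
  also have "\<dots> = (\<integral>u. x * (indicator {0<..<x} (x * u) *
      ((x - x * u) powr (\<beta> - 1) * (x * u) powr (- \<beta>) / (Gamma \<beta> * Gamma (1 - \<beta>)) * \<psi> (x * u))) \<partial>lborel)"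
    using x by (subst lborel_integral_real_affine[where c = x and t = 0]) auto
  also have "\<dots> = (\<integral>u. beta_dens \<beta> u * \<psi> (x * u) \<partial>lborel)"
  proof (rule Bochner_Integration.integral_cong)
    fix u :: real
    show "x * (indicator {0<..<x} (x * u) *
      ((x - x * u) powr (\<beta> - 1) * (x * u) powr (- \<beta>) / (Gamma \<beta> * Gamma (1 - \<beta>)) * \<psi> (x * u))) =
      beta_dens \<beta> u * \<psi> (x * u)"
    proof (cases "0 < u \<and> u < 1")
      case True
      have "x - x * u = x * (1 - u)" by (simp add: algebra_simps)
      then have "(x - x * u) powr (\<beta> - 1) * (x * u) powr (- \<beta>) =
          (x powr (\<beta> - 1) * x powr (- \<beta>)) * ((1 - u) powr (\<beta> - 1) * u powr (- \<beta>))"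
        using x True by (simp add: powr_mult)
      also have "x powr (\<beta> - 1) * x powr (- \<beta>) = x powr ((\<beta> - 1) + - \<beta>)"
        by (rule powr_add[symmetric])
      also have "\<dots> = 1 / x" using x by (simp add: powr_minus_divide)
      finally show ?thesis using x True by (simp add: beta_dens_def indicator_def)
    next
      case False
      then have "\<not> (0 < x * u \<and> x * u < x)" using x by (auto simp: zero_less_mult_iff)
      then show ?thesis using False by (auto simp: beta_dens_def)
    qed
  qed simp
  finally show ?thesis .
qed

text \<open>Under \<open>r = x * u\<close> the powers of \<open>x\<close> are \<open>1\<close>,
  \<open>\<beta> - 1\<close> and \<open>\<alpha> - \<beta>\<close>, which add up to
  \<open>\<alpha>\<close>. The constant is a Beta integral, finite because
  \<open>\<alpha> - \<beta> > -1\<close> and \<open>\<beta> > 0\<close>.\<close>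

lemma J_op_bound:
  assumes \<beta>: "0 < \<beta>" "\<beta> < 1" and \<alpha>: "0 < \<alpha>"
    and g: "\<And>x. x \<in> {0<..T} \<Longrightarrow> \<bar>g x\<bar> \<le> C * x powr (\<alpha> - \<beta>)"
  shows "\<exists>D\<ge>0. \<forall>x\<in>{0<..T}. \<bar>J_op T \<beta> g x\<bar> \<le> D * x powr \<alpha>"
proof -
  define b where "b u = indicator {0<..<1} u * ((1 - u) powr (\<beta> - 1) * u powr (\<alpha> - \<beta>) * (\<bar>C\<bar> / Gamma \<beta>))" for u :: real
  have G: "0 < Gamma \<beta>" using \<beta> by (intro Gamma_real_pos)
  have "set_integrable lborel {0..1} (\<lambda>t. t powr ((\<alpha> - \<beta> + 1) - 1) * (1 - t) powr (\<beta> - 1))"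
    using \<alpha> \<beta> by (intro integrable_Beta) auto
  then have "integrable lborel (\<lambda>u. indicator {0..1} u * (u powr (\<alpha> - \<beta>) * (1 - u) powr (\<beta> - 1)) * (\<bar>C\<bar> / Gamma \<beta>))"
    unfolding set_integrable_def by (intro integrable_mult_left) simp
  then have bint: "integrable lborel b"
    by (rule integrable_cong_AE_imp)
      (auto simp: b_def[abs_def] indicator_def
        intro!: AE_I'[of "{0, 1}"] finite_imp_null_set_lborel split: if_splits)
  have b0: "0 \<le> b u" for u using G by (simp add: b_def)
  define D where "D = (\<integral>u. b u \<partial>lborel)"
  have D0: "0 \<le> D" unfolding D_def by (rule Bochner_Integration.integral_nonneg) (rule b0)
  have "\<bar>J_op T \<beta> g x\<bar> \<le> D * x powr \<alpha>" if x: "x \<in> {0<..T}" for x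
  proof -
    let ?f = "\<lambda>r. indicator {0<..<x} r * ((x - r) powr (\<beta> - 1) / Gamma \<beta> * g r)"
    have J: "J_op T \<beta> g x = (\<integral>r. ?f r \<partial>lborel)"
      using x by (simp add: J_op_def set_lebesgue_integral_def)
    have "(\<integral>r. ?f r \<partial>lborel) = (\<integral>u. x * ?f (x * u) \<partial>lborel)"
      using x by (subst lborel_integral_real_affine[where c = x and t = 0]) auto
    also have "\<bar>\<dots>\<bar> \<le> (\<integral>u. b u * x powr \<alpha> \<partial>lborel)"
    proof (cases "integrable lborel (\<lambda>u. x * ?f (x * u))")
      case True
      show ?thesis
      proof (rule integral_abs_bound_integral[OF True])
        show "integrable lborel (\<lambda>u. b u * x powr \<alpha>)" using bint by simp
        fix u :: real
        show "\<bar>x * ?f (x * u)\<bar> \<le> b u * x powr \<alpha>"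
        proof (cases "0 < u \<and> u < 1")
          case True
          then have xu: "x * u \<in> {0<..T}" using x order_trans[OF mult_left_le[of u x], of T] by auto
          have "x - x * u = x * (1 - u)" by (simp add: algebra_simps)
          then have p: "(x - x * u) powr (\<beta> - 1) = x powr (\<beta> - 1) * (1 - u) powr (\<beta> - 1)"
            by (simp add: powr_mult)
          have "\<bar>g (x * u)\<bar> \<le> C * (x * u) powr (\<alpha> - \<beta>)" by (rule g[OF xu])
          also have "\<dots> \<le> \<bar>C\<bar> * (x powr (\<alpha> - \<beta>) * u powr (\<alpha> - \<beta>))"
            unfolding powr_mult by (intro mult_right_mono) auto
          finally have gb: "\<bar>g (x * u)\<bar> \<le> \<dots>" .
          have "\<bar>x * ?f (x * u)\<bar> = (x * x powr (\<beta> - 1) * (1 - u) powr (\<beta> - 1) / Gamma \<beta>) * \<bar>g (x * u)\<bar>"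
            using x True G unfolding p by (simp add: abs_mult)
          also have "\<dots> \<le> (x * x powr (\<beta> - 1) * (1 - u) powr (\<beta> - 1) / Gamma \<beta>) *
              (\<bar>C\<bar> * (x powr (\<alpha> - \<beta>) * u powr (\<alpha> - \<beta>)))"
            using x G by (intro mult_left_mono gb) auto
          also have "\<dots> = (x powr 1 * x powr (\<beta> - 1) * x powr (\<alpha> - \<beta>)) * ((1 - u) powr (\<beta> - 1) * u powr (\<alpha> - \<beta>) * (\<bar>C\<bar> / Gamma \<beta>))"
            using x by simp
          also have "x powr 1 * x powr (\<beta> - 1) * x powr (\<alpha> - \<beta>) = x powr \<alpha>"
            unfolding powr_add[symmetric] by simp
          finally show ?thesis using True by (simp add: b_def mult.commute)
        next
          case False
          then have "\<not> (0 < x * u \<and> x * u < x)" using x by (auto simp: zero_less_mult_iff)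
          then show ?thesis using b0[of u] by auto
        qed
      qed
    next
      \<comment> \<open>A Bochner integral that does not exist is \<open>0\<close> by convention, so
        the bound still holds.\<close>
      case False
      then show ?thesis using D0 by (subst not_integrable_integral_eq) (auto simp: D_def)
    qed
    also have "\<dots> = D * x powr \<alpha>" by (simp add: D_def)
    finally show ?thesis unfolding J .
  qed
  with D0 show ?thesis by blast
qed


text \<open>The indicator inside the integrand hides the values of \<open>g\<close> off
  \<open>(0,T]\<close>, about which nothing is assumed; the integrand becomes jointly measurable in
  \<open>x\<close> and \<open>r\<close>.\<close>

lemma measurable_J_op:
  assumes [measurable]: "(\<lambda>r. indicator {0<..T} r * g r) \<in> borel_measurable borel"
  shows "J_op T \<beta> g \<in> borel_measurable borel"
proof -
  have "J_op T \<beta> g x = (if 0 < x \<and> x \<le> T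
      then \<integral>r. (if 0 < r \<and> r < x then (x - r) powr (\<beta> - 1) / Gamma \<beta> * (indicator {0<..T} r * g r) else 0) \<partial>lborel
      else 0)" for x
    unfolding J_op_def set_lebesgue_integral_def
    by (intro if_cong refl Bochner_Integration.integral_cong) (auto simp: indicator_def)
  then show ?thesis by (simp only: cong: measurable_cong) measurable
qed

section \<open>Iterates of the operator as expectations along the chain\<close>

context beta_sequence
begin

lemma integrable_beta_chain:
  fixes f :: "real \<Rightarrow> real"
  assumes [measurable]: "f \<in> borel_measurable borel" and bd: "\<And>z. \<bar>f z\<bar> \<le> C"
  shows "integrable N (\<lambda>\<omega>. f (beta_chain B x j \<omega>))"
  by (rule integrable_const_bound[of _ C]) (use bd in auto)

text \<open>The chain is linear in its starting point, so its last factor can be moved to the start.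
  Integrating over that factor gives the order of composition in which \<open>K_op\<close> is
  iterated.\<close>

lemma expectation_beta_chain_Suc:
  fixes f :: "real \<Rightarrow> real"
  assumes \<beta>: "0 < \<beta>" "\<beta> < 1"
    and f[measurable]: "f \<in> borel_measurable borel" and bd: "\<And>z. \<bar>f z\<bar> \<le> C"
  shows "expectation (\<lambda>\<omega>. f (beta_chain B x (Suc j) \<omega>)) =
    (\<integral>u. beta_dens \<beta> u * expectation (\<lambda>\<omega>. f (beta_chain B (x * u) j \<omega>)) \<partial>lborel)"
proof -
  let ?V = "distr N borel (beta_chain B x j)"
  have [measurable]: "beta_dens \<beta> \<in> borel_measurable borel" unfolding beta_dens_def[abs_def] by measurable
  have [measurable]: "B (Suc j) \<in> borel_measurable N" by (rule measurable_B) simp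
  interpret V: prob_space ?V by (rule prob_space_distr) simp
  interpret L: prob_space beta_law by (rule prob_space_beta_law)
  interpret P: pair_prob_space ?V beta_law ..
  have joint: "?V \<Otimes>\<^sub>M beta_law = distr N (borel \<Otimes>\<^sub>M borel) (\<lambda>\<omega>. (beta_chain B x j \<omega>, B (Suc j) \<omega>))"
    using joint_beta_chain[of x j] by (simp add: distr_B)
  have int: "integrable (?V \<Otimes>\<^sub>M beta_law) (\<lambda>(v, u). f (v * u))"
    by (rule P.P.integrable_const_bound[of _ C]) (use bd in auto)
  have "expectation (\<lambda>\<omega>. f (beta_chain B x (Suc j) \<omega>)) = (\<integral>z. (case z of (v, u) \<Rightarrow> f (v * u)) \<partial>(?V \<Otimes>\<^sub>M beta_law))"
    unfolding joint by (subst integral_distr) (auto simp: beta_chain_Suc)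
  also have "\<dots> = (\<integral>u. (\<integral>v. f (v * u) \<partial>?V) \<partial>beta_law)"
    by (rule P.integral_snd[OF int, symmetric])
  also have "\<dots> = (\<integral>u. beta_dens \<beta> u *\<^sub>R (\<integral>v. f (v * u) \<partial>?V) \<partial>lborel)"
  proof (rule integral_density)
    show "AE u in lborel. 0 \<le> beta_dens \<beta> u"
      using \<beta> by (auto simp: beta_dens_def Gamma_real_pos less_imp_le)
  qed measurable
  also have "\<dots> = (\<integral>u. beta_dens \<beta> u * expectation (\<lambda>\<omega>. f (beta_chain B (x * u) j \<omega>)) \<partial>lborel)"
  proof (intro Bochner_Integration.integral_cong refl)
    fix u
    have "beta_chain B (x * u) j \<omega> = beta_chain B x j \<omega> * u" for \<omega>
      by (simp add: beta_chain_def)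
    then show "beta_dens \<beta> u *\<^sub>R (\<integral>v. f (v * u) \<partial>?V) = beta_dens \<beta> u * expectation (\<lambda>\<omega>. f (beta_chain B (x * u) j \<omega>))"
      by (subst integral_distr) auto
  qed
  finally show ?thesis .
qed

text \<open>The induction is over all starting points because one step leads from \<open>x\<close>
  to \<open>x * u\<close>; with \<open>0 < u < 1\<close> this stays in \<open>(0,T]\<close>.\<close>

lemma K_op_funpow_eq_expectation:
  fixes f :: "real \<Rightarrow> real"
  assumes \<beta>: "0 < \<beta>" "\<beta> < 1"
    and f: "f \<in> borel_measurable borel" and bd: "\<And>z. \<bar>f z\<bar> \<le> C"
  shows "0 < x \<Longrightarrow> x \<le> T \<Longrightarrow> (K_op T \<beta> ^^ j) f x = expectation (\<lambda>\<omega>. f (beta_chain B x j \<omega>))"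
proof (induction j arbitrary: x)
  case 0
  then show ?case by (simp add: beta_chain_def prob_space)
next
  case (Suc j)
  have "(K_op T \<beta> ^^ Suc j) f x = (\<integral>u. beta_dens \<beta> u * (K_op T \<beta> ^^ j) f (x * u) \<partial>lborel)"
    using Suc.prems by (simp add: K_op_eq_beta_integral)
  also have "\<dots> = (\<integral>u. beta_dens \<beta> u * expectation (\<lambda>\<omega>. f (beta_chain B (x * u) j \<omega>)) \<partial>lborel)"
  proof (intro Bochner_Integration.integral_cong refl)
    fix u
    show "beta_dens \<beta> u * (K_op T \<beta> ^^ j) f (x * u) = beta_dens \<beta> u * expectation (\<lambda>\<omega>. f (beta_chain B (x * u) j \<omega>))"
    proof (cases "0 < u \<and> u < 1")
      case True
      then have "0 < x * u" "x * u \<le> T"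
        using Suc.prems order_trans[OF mult_left_le[of u x], of T] by auto
      then show ?thesis by (simp add: Suc.IH)
    qed (auto simp: beta_dens_def)
  qed
  also have "\<dots> = expectation (\<lambda>\<omega>. f (beta_chain B x (Suc j) \<omega>))"
    by (rule expectation_beta_chain_Suc[OF \<beta> f bd, symmetric])
  finally show ?case .
qed

lemma beta_chain_moment:
  assumes \<alpha>: "0 < \<alpha>" and x: "0 < x"
  shows "\<exists>m. 0 \<le> m \<and> m < 1 \<and> (\<forall>j. integrable N (\<lambda>\<omega>. beta_chain B x j \<omega> powr \<alpha>) \<and>
    expectation (\<lambda>\<omega>. beta_chain B x j \<omega> powr \<alpha>) = x powr \<alpha> * m ^ j)"
proof -
  define m where "m = (\<integral>u. u powr \<alpha> \<partial>beta_law)"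
  have ind: "indep_vars (\<lambda>_. borel) B {1..}" using B_iid by (simp add: iid_vars_def)
  have int: "integrable N (\<lambda>\<omega>. B i \<omega> powr \<alpha>)" if i: "1 \<le> i" for i
  proof (rule integrable_const_bound[of _ 1])
    show "AE \<omega> in N. norm (B i \<omega> powr \<alpha>) \<le> 1"
      using AE_B[OF i] by eventually_elim (use \<alpha> in \<open>auto intro!: powr_le1\<close>)
    show "(\<lambda>\<omega>. B i \<omega> powr \<alpha>) \<in> borel_measurable N" using measurable_B[OF i] by measurable
  qed
  have mean: "expectation (\<lambda>\<omega>. B i \<omega> powr \<alpha>) = m" if i: "1 \<le> i" for i
    unfolding m_def distr_B[OF i, symmetric] using measurable_B[OF i] by (subst integral_distr) auto
  \<comment> \<open>The strict inequality holds almost surely and passes to the expectation; it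
    makes the ratio \<open>m\<close> smaller than \<open>1\<close>.\<close>
  have "expectation (\<lambda>\<omega>. B 1 \<omega> powr \<alpha>) < 1"
  proof (rule expectation_less[OF int])
    show "AE \<omega> in N. B 1 \<omega> powr \<alpha> < 1"
      using AE_B[OF order_refl]
    proof eventually_elim
      case (elim \<omega>)
      then show ?case using powr_less_mono2[OF \<alpha>, of "B 1 \<omega>" 1] by simp
    qed
  qed simp
  then have "m < 1" by (simp add: mean)
  moreover have "0 \<le> m" unfolding m_def by (rule Bochner_Integration.integral_nonneg) auto
  moreover have "integrable N (\<lambda>\<omega>. beta_chain B x j \<omega> powr \<alpha>) \<and>
    expectation (\<lambda>\<omega>. beta_chain B x j \<omega> powr \<alpha>) = x powr \<alpha> * m ^ j" for j
  proof -
    have eq: "beta_chain B x j \<omega> powr \<alpha> = x powr \<alpha> * (\<Prod>i\<in>{1..j}. B i \<omega> powr \<alpha>)" for \<omega>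
      unfolding beta_chain_def by (simp add: powr_mult prod_powr_distrib)
    have ind': "indep_vars (\<lambda>_. borel) (\<lambda>i \<omega>. B i \<omega> powr \<alpha>) {1..j}"
      by (rule indep_vars_compose2[OF indep_vars_subset[OF ind]]) auto
    have "integrable N (\<lambda>\<omega>. \<Prod>i\<in>{1..j}. B i \<omega> powr \<alpha>)"
      by (rule indep_vars_integrable[OF _ ind' int]) auto
    moreover have "expectation (\<lambda>\<omega>. \<Prod>i\<in>{1..j}. B i \<omega> powr \<alpha>) = m ^ j"
      by (subst indep_vars_lebesgue_integral[OF _ ind' int]) (auto simp: mean)
    ultimately show ?thesis unfolding eq by simp
  qed
  ultimately show ?thesis by blast
qed

theorem I_op_eq_suminf_expectation:
  assumes \<beta>: "0 < \<beta>" "\<beta> < 1" and \<alpha>: "0 < \<alpha>"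
    and meas: "(\<lambda>r. indicator {0<..T} r * g r) \<in> borel_measurable borel"
    and g: "\<And>x. x \<in> {0<..T} \<Longrightarrow> \<bar>g x\<bar> \<le> C * x powr (\<alpha> - \<beta>)"
    and x: "x \<in> {0<..T}"
  shows "summable (\<lambda>j. (K_op T \<beta> ^^ j) (J_op T \<beta> g) x)"
    "integrable N (\<lambda>\<omega>. J_op T \<beta> g (beta_chain B x j \<omega>))"
    "summable (\<lambda>j. expectation (\<lambda>\<omega>. J_op T \<beta> g (beta_chain B x j \<omega>)))"
    "I_op T \<beta> g x = (\<Sum>j. expectation (\<lambda>\<omega>. J_op T \<beta> g (beta_chain B x j \<omega>)))"
proof -
  note [measurable] = measurable_J_op[OF meas, of \<beta>]
  obtain D where D: "0 \<le> D" "\<And>y. y \<in> {0<..T} \<Longrightarrow> \<bar>J_op T \<beta> g y\<bar> \<le> D * y powr \<alpha>"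
    using J_op_bound[where g = g and T = T, OF \<beta> \<alpha> g] by blast
  \<comment> \<open>\<open>J_op\<close> is \<open>0\<close> off \<open>(0,T]\<close>, so both bounds
    hold on the whole line and apply to every value of the chain.\<close>
  have Dall: "\<bar>J_op T \<beta> g y\<bar> \<le> D * y powr \<alpha>" for y
    using D(1) D(2)[of y] by (cases "y \<in> {0<..T}") (auto simp: J_op_def)
  have bd: "\<bar>J_op T \<beta> g y\<bar> \<le> D * T powr \<alpha>" for y
  proof (cases "y \<in> {0<..T}")
    case True
    then have "D * y powr \<alpha> \<le> D * T powr \<alpha>" using D(1) \<alpha> by (intro mult_left_mono powr_mono2) auto
    then show ?thesis using D(2)[OF True] by linarith
  next
    case False
    then show ?thesis using D(1) by (auto simp: J_op_def)
  qed
  have eq: "(\<lambda>j. (K_op T \<beta> ^^ j) (J_op T \<beta> g) x) = (\<lambda>j. expectation (\<lambda>\<omega>. J_op T \<beta> g (beta_chain B x j \<omega>)))"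
    using K_op_funpow_eq_expectation[OF \<beta> _ bd, where x = x] x by auto
  show int: "integrable N (\<lambda>\<omega>. J_op T \<beta> g (beta_chain B x j \<omega>))" for j
    by (rule integrable_beta_chain[OF _ bd]) simp
  have x0: "0 < x" using x by simp
  obtain m where m: "0 \<le> m" "m < 1" "\<And>j. integrable N (\<lambda>\<omega>. beta_chain B x j \<omega> powr \<alpha>)"
      "\<And>j. expectation (\<lambda>\<omega>. beta_chain B x j \<omega> powr \<alpha>) = x powr \<alpha> * m ^ j"
    using beta_chain_moment[OF \<alpha> x0] by blast
  show summ: "summable (\<lambda>j. expectation (\<lambda>\<omega>. J_op T \<beta> g (beta_chain B x j \<omega>)))"
  proof (rule summable_comparison_test')
    show "summable (\<lambda>j. D * (x powr \<alpha> * m ^ j))"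
      using m by (intro summable_mult summable_geometric) auto
    fix j
    have "\<bar>expectation (\<lambda>\<omega>. J_op T \<beta> g (beta_chain B x j \<omega>))\<bar> \<le> expectation (\<lambda>\<omega>. D * beta_chain B x j \<omega> powr \<alpha>)"
      using integrable_abs[OF int] m(3)
      by (intro order_trans[OF integral_abs_bound] integral_mono) (auto intro: Dall)
    then show "norm (expectation (\<lambda>\<omega>. J_op T \<beta> g (beta_chain B x j \<omega>))) \<le> D * (x powr \<alpha> * m ^ j)"
      by (simp add: m(4))
  qed
  then show "summable (\<lambda>j. (K_op T \<beta> ^^ j) (J_op T \<beta> g) x)" unfolding eq .
  show "I_op T \<beta> g x = (\<Sum>j. expectation (\<lambda>\<omega>. J_op T \<beta> g (beta_chain B x j \<omega>)))"
    unfolding I_op_def eq ..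
qed

end

text \<open>Summability and integrability are asserted explicitly, since \<open>suminf\<close> and
  the expectation take some value in any case.\<close>

theorem proposition4p8:
  fixes \<beta> T :: real
    and g :: "real \<Rightarrow> real"
    and M :: "'a measure" and S :: "nat \<Rightarrow> real \<Rightarrow> 'a \<Rightarrow> real"
    and N :: "'b measure" and B :: "nat \<Rightarrow> 'b \<Rightarrow> real"
  assumes \<beta>: "0 < \<beta>" "\<beta> < 1" and T: "0 < T"
    and S: "prob_space M"
      "\<And>j. 1 \<le> j \<Longrightarrow> stable_subordinator M \<beta> (\<lambda>t \<omega>. - S j t \<omega>)"
      "iid_vars M path_space (\<lambda>j. path_of (\<lambda>t \<omega>. - S j t \<omega>)) {1..}"
    and B: "prob_space N"
      "\<And>i. 1 \<le> i \<Longrightarrow> distributed N lborel (B i) (\<lambda>r. ennreal (beta_dens \<beta> r))"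
      "iid_vars N borel B {1..}"
    and g: "(continuous_on {0<..T} g \<and>
              (\<exists>C \<alpha>. 0 < C \<and> 0 < \<alpha> \<and> (\<forall>x\<in>{0<..T}. \<bar>g x\<bar> \<le> C * x powr (\<alpha> - \<beta>)))) \<or>
            bounded_borel_on {0..T} g"
  shows "(\<forall>x>0. \<forall>j\<ge>1.
            eq_in_law borel_cemetery
              M (\<lambda>\<omega>. censored (\<lambda>i t. S i t \<omega>) x (cens_time (\<lambda>i t. S i t \<omega>) x j))
              N (\<lambda>\<omega>. Some (beta_chain B x j \<omega>))) \<and>
         (\<forall>x\<in>{0<..T}.
            summable (\<lambda>j. (K_op T \<beta> ^^ j) (J_op T \<beta> g) x) \<and>
            (\<forall>j. integrable N (\<lambda>\<omega>. J_op T \<beta> g (beta_chain B x j \<omega>))) \<and>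
            summable (\<lambda>j. prob_space.expectation N (\<lambda>\<omega>. J_op T \<beta> g (beta_chain B x j \<omega>))) \<and>
            I_op T \<beta> g x =
              (\<Sum>j. prob_space.expectation N (\<lambda>\<omega>. J_op T \<beta> g (beta_chain B x j \<omega>))))"
proof -
  interpret censored_setting N \<beta> B M S
    by (intro censored_setting.intro beta_sequence.intro censored_setting_axioms.intro B \<beta> S)
  obtain C \<alpha> where \<alpha>: "0 < \<alpha>" and bound: "\<And>x. x \<in> {0<..T} \<Longrightarrow> \<bar>g x\<bar> \<le> C * x powr (\<alpha> - \<beta>)"
    and meas: "(\<lambda>r. indicator {0<..T} r * g r) \<in> borel_measurable borel"
    using g
  proof
    assume g1: "continuous_on {0<..T} g \<and>
      (\<exists>C \<alpha>. 0 < C \<and> 0 < \<alpha> \<and> (\<forall>x\<in>{0<..T}. \<bar>g x\<bar> \<le> C * x powr (\<alpha> - \<beta>)))"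
    then have "(\<lambda>r. indicator {0<..T} r * g r) \<in> borel_measurable borel"
      using borel_measurable_continuous_on_indicator[of "{0<..T}" g] by simp
    with g1 that show thesis by blast
  next
    assume g2: "bounded_borel_on {0..T} g"
    then have "(\<lambda>r. indicator {0..T} r * g r) \<in> borel_measurable borel"
      by (simp add: bounded_borel_on_def borel_measurable_restrict_space_iff)
    then have "(\<lambda>r. indicator {0<..T} r * (indicator {0..T} r * g r)) \<in> borel_measurable borel"
      by measurable
    also have "(\<lambda>r. indicator {0<..T} r * (indicator {0..T} r * g r)) = (\<lambda>r. indicator {0<..T} r * g r)"
      by (auto simp: indicator_def)
    finally have meas: "(\<lambda>r. indicator {0<..T} r * g r) \<in> borel_measurable borel" .
    obtain C where "\<And>x. x \<in> {0..T} \<Longrightarrow> \<bar>g x\<bar> \<le> C"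
      using g2 unfolding bounded_borel_on_def bounded_iff real_norm_def by blast
    \<comment> \<open>A bounded \<open>g\<close> is the case \<open>\<alpha> = \<beta>\<close>: the
      power of \<open>x\<close> is then \<open>1\<close>.\<close>
    then have "\<bar>g x\<bar> \<le> C * x powr (\<beta> - \<beta>)" if "x \<in> {0<..T}" for x
      using that by simp
    with meas \<beta>(1) that show thesis by blast
  qed
  show ?thesis
    using eq_in_law_censored I_op_eq_suminf_expectation[OF \<beta> \<alpha> meas bound] by blast
qed

end
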